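(* Let $\psi$ be a conformal map on the unit disk $\mathbb{D}$ with $\psi(0)=0$, and for $\alpha>0$ let $F_\alpha=\{z\in\mathbb{D}:|\psi(z)|=\alpha\}$. Suppose that the limit $$\mu:=\lim_{\alpha\to+\infty}\frac{d_{\mathbb{D}}(0,F_\alpha)}{\log\alpha}$$ exists in $[0,+\infty]$. Then the limit $$L:=\lim_{\alpha\to+\infty}\frac{\log\left(\omega_{\mathbb{D}}(0,F_\alpha)^{-1}\right)}{\log\alpha}$$ exists in $[0,+\infty]$, and $L=\mu$.
   Context: A conformal map on $\mathbb{D}=\{z\in\mathbb{C}:|z|<1\}$ is an injective holomorphic function $\psi:\mathbb{D}\to\mathbb{C}$. Hyperbolic distance: for $z,w\in\mathbb{D}$, $d_{\mathbb{D}}(z,w)=\log\frac{1+\left|\frac{z-w}{1-z\bar w}\right|}{1-\left|\frac{z-w}{1-z\bar w}\right|}$; for a set $E\subset\mathbb{D}$, $d_{\mathbb{D}}(z,E)=\inf\{d_{\mathbb{D}}(z,w):w\in E\}$ (with $\inf\emptyset=+\infty$). Harmonic measure: for a domain $D$, $z\in D$ and a Borel set $E\subset\overline{D}$, $\omega_D(z,E)$ denotes the harmonic measure at $z$ of $E$ with respect to the component of $D\setminus E$ containing $z$; i.e. $\omega_D(\cdot,E)$ is the solution of the generalized Dirichlet problem in that component with boundary data $1_E$. If $F_\alpha=\emptyset$, then $\omega_{\mathbb{D}}(0,F_\alpha)=0$ and $\log(\omega_{\mathbb{D}}(0,F_\alpha)^{-1})=+\infty$. *)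

theory Defs
  imports "HOL-Complex_Analysis.Complex_Analysis"
begin

abbreviation unit_disc :: "complex set" where
  "unit_disc \<equiv> ball 0 1"

definition conformal_map_on_disc :: "(complex \<Rightarrow> complex) \<Rightarrow> bool" where
  "conformal_map_on_disc \<psi> \<longleftrightarrow> \<psi> holomorphic_on unit_disc \<and> inj_on \<psi> unit_disc"

definition level_set :: "(complex \<Rightarrow> complex) \<Rightarrow> real \<Rightarrow> complex set" where
  "level_set \<psi> \<alpha> = {z \<in> unit_disc. cmod (\<psi> z) = \<alpha>}"

definition hyp_dist :: "complex \<Rightarrow> complex \<Rightarrow> real" where
  "hyp_dist z w =
     ln ((1 + cmod ((z - w) / (1 - z * cnj w))) / (1 - cmod ((z - w) / (1 - z * cnj w))))"

(* Extended-real valued, so that the distance to the empty set is \<infinity>. *)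
definition hyp_setdist :: "complex \<Rightarrow> complex set \<Rightarrow> ereal" where
  "hyp_setdist z E = (INF w\<in>E. ereal (hyp_dist z w))"

(* Subharmonicity on an open set in the form used in Perron's method: continuous, real-valued,
   and satisfying the sub-mean value inequality on all sufficiently small circles. *)
definition subharmonic_on :: "(complex \<Rightarrow> real) \<Rightarrow> complex set \<Rightarrow> bool" where
  "subharmonic_on u S \<longleftrightarrow>
     continuous_on S u \<and>
     (\<forall>w\<in>S. \<exists>\<rho>>0. ball w \<rho> \<subseteq> S \<and>
        (\<forall>r. 0 < r \<and> r < \<rho> \<longrightarrow>
           u w \<le> (1 / (2 * pi)) * integral {0..2 * pi} (\<lambda>t. u (w + of_real r * cis t))))"

(* The Perron subfunctions on an open set S for the boundary data \<phi>.  The boundary is taken in the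
   Riemann sphere, with value 0 at the point at infinity; when S is bounded, the last condition
   holds vacuously. *)
definition perron_family :: "complex set \<Rightarrow> (complex \<Rightarrow> real) \<Rightarrow> (complex \<Rightarrow> real) set" where
  "perron_family S \<phi> =
     {u. subharmonic_on u S \<and>
         (\<forall>\<zeta>\<in>frontier S. Limsup (at \<zeta> within S) (\<lambda>z. ereal (u z)) \<le> ereal (\<phi> \<zeta>)) \<and>
         Limsup (inf at_infinity (principal S)) (\<lambda>z. ereal (u z)) \<le> 0}"

(* Perron's solution of the generalized Dirichlet problem: the upper envelope of the subfunctions. *)
definition perron_solution :: "complex set \<Rightarrow> (complex \<Rightarrow> real) \<Rightarrow> complex \<Rightarrow> real" where
  "perron_solution S \<phi> z = (SUP u\<in>perron_family S \<phi>. u z)"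

(* Harmonic measure at z \<in> D - E, for E relatively closed in the domain D, so that the component
   of D - E containing z is again a domain. *)
definition harmonic_measure :: "complex set \<Rightarrow> complex \<Rightarrow> complex set \<Rightarrow> real" where
  "harmonic_measure D z E =
     perron_solution (connected_component_set (D - E) z) (indicator E) z"

(* log (1/x) for x \<ge> 0, with log (1/0) = \<infinity>. *)
definition log_inverse :: "real \<Rightarrow> ereal" where
  "log_inverse x = (if x = 0 then \<infinity> else ereal (ln (inverse x)))"

end

theory Submission
  imports Defs "HOL-Computational_Algebra.Fundamental_Theorem_Algebra"
begin

text \<open>
  Write \<open>F\<^sub>\<alpha>\<close> for the level set. Both quantities are compared with \<open>1 - r\<close>, where \<open>r\<close> is the distance
  of a level set from \<open>0\<close>; a change of \<open>\<alpha>\<close> by a constant factor does not affect the limits.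

  Upper bound (Cartan's identity from Nevanlinna theory). For \<open>|w| = R\<close> add to \<open>ln |\<psi> / w - 1|\<close> the
  Green function of the disc at the only possible zero. This is a harmonic function whose value at
  \<open>0\<close> is at most \<open>ln (1 / r)\<close>, with \<open>r\<close> the distance of \<open>F\<^sub>R\<close> from \<open>0\<close>. Its average over \<open>N\<close> points
  \<open>w\<close>, equally spaced on the circle, is at least \<open>- (ln N + c) / N\<close> on a smaller disc and at least
  \<open>1\<close> where \<open>|\<psi>| \<ge> 4 R\<close>, so \<open>\<omega>(0, F\<^sub>4\<^sub>R) \<le> ln (1 / r)\<close>.

  Lower bound. For \<open>|\<psi> z0| > \<alpha>\<close> the maximum principle gives on every circle about \<open>z0\<close> a point with
  \<open>|\<psi>| \<ge> |\<psi> z0|\<close>. The average of the Green functions at \<open>N\<close> such points, on circles whose radii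
  fill an interval of length \<open>(1 - |z0|) / 2\<close>, is bounded on \<open>|\<psi>| \<le> \<alpha>\<close> by an absolute constant
  because \<open>ln (1 / t)\<close> is integrable at \<open>0\<close>, and is at least \<open>(1 - |z0|) / 2\<close> at \<open>0\<close>.
\<close>

section \<open>Subharmonic functions\<close>

lemma mean_value_circle:
  assumes f: "f holomorphic_on S" and sub: "ball w \<rho> \<subseteq> S" and r: "0 < r" "r < \<rho>"
  shows "((\<lambda>t. f (w + of_real r * cis t)) has_integral (2 * of_real pi * f w)) {0..2*pi}"
proof -
  have sub': "cball w r \<subseteq> S"
    using sub r by (force simp: subset_iff)
  have "((\<lambda>u. f u / (u - w)) has_contour_integral (2 * of_real pi * \<i> * f w)) (circlepath w r)"
    using r sub' by (intro Cauchy_integral_circlepath)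
      (auto intro!: holomorphic_on_imp_continuous_on holomorphic_on_subset[OF f])
  then have "((\<lambda>t. f (w + r * cis t) / (w + r * cis t - w) * r * \<i> * cis t) has_integral
      (2 * of_real pi * \<i> * f w)) {0..2*pi}"
    unfolding circlepath_def by (subst (asm) has_contour_integral_part_circlepath_iff) auto
  then have "((\<lambda>t. \<i> * f (w + r * cis t)) has_integral (\<i> * (2 * of_real pi * f w))) {0..2*pi}"
    using r by (simp add: mult_ac)
  from has_integral_mult_right[OF this, of "- \<i>"] show ?thesis
    by (simp flip: mult.assoc)
qed

text \<open>On the ball, which is contractible, \<open>f\<close> has a holomorphic logarithm
  \<open>g\<close>; then \<open>ln (cmod (f z))\<close> is \<open>Re (g z)\<close>, and the mean
  value property of \<open>g\<close> applies.\<close>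

lemma ln_cmod_mean_value:
  assumes f: "f holomorphic_on S" and nz: "\<And>z. z \<in> S \<Longrightarrow> f z \<noteq> 0"
    and sub: "ball w \<rho> \<subseteq> S" and r: "0 < r" "r < \<rho>"
  shows "((\<lambda>t. ln (cmod (f (w + of_real r * cis t)))) has_integral (2 * pi * ln (cmod (f w)))) {0..2*pi}"
proof -
  obtain g where g: "g holomorphic_on ball w \<rho>" "\<And>z. z \<in> ball w \<rho> \<Longrightarrow> f z = exp (g z)"
    using contractible_imp_holomorphic_log[of f "ball w \<rho>"] f nz sub
    by (metis convex_ball convex_imp_contractible holomorphic_on_subset subset_iff)
  have "((\<lambda>t. Re (g (w + of_real r * cis t))) has_integral Re (2 * of_real pi * g w)) {0..2*pi}"
    by (intro has_integral_Re mean_value_circle[OF g(1) order_refl r])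
  then have 1: "((\<lambda>t. Re (g (w + of_real r * cis t))) has_integral 2 * pi * Re (g w)) {0..2*pi}"
    by simp
  have 2: "ln (cmod (f (w + of_real r * cis t))) = Re (g (w + of_real r * cis t))" for t
    using r by (subst g(2)) (auto simp: dist_norm norm_mult)
  have 3: "ln (cmod (f w)) = Re (g w)"
    using r by (subst g(2)) auto
  show ?thesis unfolding 2 3 by (rule 1)
qed

text \<open>The mean value property holds with equality, so \<open>c\<close> may have either
  sign.\<close>

lemma subharmonic_on_scaled_ln_cmod:
  assumes "open S" and f: "f holomorphic_on S" and nz: "\<And>z. z \<in> S \<Longrightarrow> f z \<noteq> 0"
  shows "subharmonic_on (\<lambda>z. c * ln (cmod (f z))) S"
  unfolding subharmonic_on_def
proof (intro conjI ballI)
  show "continuous_on S (\<lambda>z. c * ln (cmod (f z)))"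
    using f nz by (intro continuous_intros holomorphic_on_imp_continuous_on) auto
  fix w assume "w \<in> S"
  then obtain \<rho> where \<rho>: "\<rho> > 0" "ball w \<rho> \<subseteq> S"
    using \<open>open S\<close> by (meson openE)
  have "c * ln (cmod (f w)) = 1 / (2 * pi) * integral {0..2 * pi} (\<lambda>t. c * ln (cmod (f (w + of_real r * cis t))))"
    if "0 < r" "r < \<rho>" for r
    by (subst integral_unique[OF has_integral_mult_right[OF ln_cmod_mean_value[OF f nz \<rho>(2) that], of c]]) auto
  with \<rho> show "\<exists>\<rho>>0. ball w \<rho> \<subseteq> S \<and> (\<forall>r. 0 < r \<and> r < \<rho> \<longrightarrow> c * ln (cmod (f w)) \<le>
      1 / (2 * pi) * integral {0..2 * pi} (\<lambda>t. c * ln (cmod (f (w + of_real r * cis t)))))"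
    by (metis order_refl)
qed

text \<open>Adding a harmonic function keeps the sub-mean value inequality for either sign of
  \<open>c\<close>. The form suits the comparison of a Perron subfunction with the harmonic
  majorant: there \<open>c\<close> is \<open>- 1 / N\<close> and \<open>T\<close> is a smaller
  region.\<close>

lemma subharmonic_on_add_scaled_ln_cmod:
  assumes u: "subharmonic_on u S" and T: "open T" "T \<subseteq> S"
    and f: "f holomorphic_on T" and nz: "\<And>z. z \<in> T \<Longrightarrow> f z \<noteq> 0"
  shows "subharmonic_on (\<lambda>z. u z + c * ln (cmod (f z)) + d) T"
  unfolding subharmonic_on_def
proof (intro conjI ballI)
  have cu: "continuous_on T u"
    using u T continuous_on_subset unfolding subharmonic_on_def by blast
  then show "continuous_on T (\<lambda>z. u z + c * ln (cmod (f z)) + d)"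
    using f nz by (intro continuous_intros holomorphic_on_imp_continuous_on) auto
  fix w assume "w \<in> T"
  then obtain \<rho>1 where \<rho>1: "\<rho>1 > 0" "ball w \<rho>1 \<subseteq> T"
    using \<open>open T\<close> by (meson openE)
  obtain \<rho>2 where \<rho>2: "\<rho>2 > 0" "\<And>r. 0 < r \<Longrightarrow> r < \<rho>2 \<Longrightarrow>
      u w \<le> 1 / (2 * pi) * integral {0..2 * pi} (\<lambda>t. u (w + of_real r * cis t))"
    using u T \<open>w \<in> T\<close> unfolding subharmonic_on_def by blast
  have "u w + c * ln (cmod (f w)) + d \<le> 1 / (2 * pi) *
      integral {0..2 * pi} (\<lambda>t. u (w + of_real r * cis t) + c * ln (cmod (f (w + of_real r * cis t))) + d)"
    if r: "0 < r" "r < min \<rho>1 \<rho>2" for r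
  proof -
    have "w + of_real r * cis t \<in> T" for t
      using \<rho>1 r by (auto simp: subset_iff dist_norm norm_mult)
    then have "(\<lambda>t. u (w + of_real r * cis t)) integrable_on {0..2*pi}"
      by (intro integrable_continuous_interval continuous_on_compose2[OF cu] continuous_intros) auto
    then have i1: "((\<lambda>t. u (w + of_real r * cis t)) has_integral
        integral {0..2*pi} (\<lambda>t. u (w + of_real r * cis t))) {0..2*pi}"
      by (rule integrable_integral)
    have i2: "((\<lambda>t. c * ln (cmod (f (w + of_real r * cis t)))) has_integral (c * (2 * pi * ln (cmod (f w))))) {0..2*pi}"
      using r \<rho>1 by (intro has_integral_mult_right ln_cmod_mean_value[OF f nz, of w \<rho>1]) auto
    have i3: "((\<lambda>t. d) has_integral (2*pi*d)) {0..2*pi}"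
      using has_integral_const_real[of d 0 "2*pi"] by simp
    show ?thesis
      using \<rho>2(2)[of r] r
      by (subst integral_unique[OF has_integral_add[OF has_integral_add[OF i1 i2] i3]]) (simp add: field_simps)
  qed
  with \<rho>1 \<rho>2(1) show "\<exists>\<rho>>0. ball w \<rho> \<subseteq> T \<and> (\<forall>r. 0 < r \<and> r < \<rho> \<longrightarrow> u w + c * ln (cmod (f w)) + d \<le> 1 / (2 * pi) *
      integral {0..2 * pi} (\<lambda>t. u (w + of_real r * cis t) + c * ln (cmod (f (w + of_real r * cis t))) + d))"
    by (intro exI[of _ "min \<rho>1 \<rho>2"]) (auto simp: subset_iff)
qed

text \<open>At a maximum point with largest real part the mean value inequality fails, since every small circle
  about it contains a point outside the maximum set.\<close>

lemma subharmonic_maximum_principle: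
  assumes v: "subharmonic_on v S" and "bounded S" "open S"
    and bd: "\<And>\<zeta> \<epsilon>. \<zeta> \<in> frontier S \<Longrightarrow> \<epsilon> > 0 \<Longrightarrow> eventually (\<lambda>z. v z < \<epsilon>) (at \<zeta> within S)"
    and "z \<in> S"
  shows "v z \<le> 0"
proof (rule ccontr)
  assume "\<not> v z \<le> 0"
  define K where "K = {x \<in> S. v z \<le> v x}"
  have cv: "continuous_on S v" using v unfolding subharmonic_on_def by blast
  \<comment> \<open>At a frontier point, \<open>bd\<close> with \<open>v z\<close> as \<epsilon>
    forces values below \<open>v z\<close> nearby, so \<open>K\<close> cannot accumulate there. This
    makes \<open>K\<close> compact although \<open>v\<close> is controlled on the frontier only
    through limits.\<close>
  have "closed K"
  proof -
    have "x \<in> K" if x: "x islimpt K" for x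
    proof (cases "x \<in> S")
      case True
      have "K = S \<inter> v -` {v z..}" by (auto simp: K_def)
      then have "closedin (top_of_set S) K"
        using continuous_closedin_preimage[OF cv closed_atLeast[of "v z"]] by simp
      then show ?thesis using x True by (metis closedin_limpt)
    next
      case False
      have "x \<in> frontier S"
        using x False \<open>open S\<close> islimpt_subset[of x K S] unfolding K_def
        by (auto simp: frontier_def interior_open closure_def)
      from bd[OF this, of "v z"] \<open>\<not> v z \<le> 0\<close> have "eventually (\<lambda>y. v y < v z) (at x within S)" by simp
      then have "eventually (\<lambda>y. y \<notin> K) (at x)"
        unfolding eventually_at_filter by eventually_elim (auto simp: K_def)
      then show ?thesis
        using x by (simp add: islimpt_iff_eventually)
    qed
    then show ?thesis by (simp add: closed_limpt)
  qed
  moreover have "K \<subseteq> S" by (auto simp: K_def)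
  ultimately have "compact K"
    using bounded_subset[OF \<open>bounded S\<close>] by (simp add: compact_eq_bounded_closed)
  moreover have "K \<noteq> {}" using \<open>z \<in> S\<close> by (auto simp: K_def)
  moreover have cK: "continuous_on K v" using cv by (rule continuous_on_subset) (auto simp: K_def)
  ultimately obtain m where m: "m \<in> K" "\<And>x. x \<in> K \<Longrightarrow> v x \<le> v m"
    using continuous_attains_sup by metis
  then have max: "v x \<le> v m" if "x \<in> S" for x
    using that by (cases "x \<in> K") (fastforce simp: K_def)+
  define A where "A = {x \<in> K. v x = v m}"
  have "closedin (top_of_set K) A"
    unfolding A_def by (rule continuous_closedin_preimage_constant[OF cK])
  then have "compact A"
    using closedin_compact \<open>compact K\<close> by blast
  moreover have "A \<noteq> {}" using m by (auto simp: A_def)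
  moreover have "continuous_on A Re" by (intro continuous_intros)
  ultimately obtain q where q: "q \<in> A" "\<And>x. x \<in> A \<Longrightarrow> Re x \<le> Re q"
    using continuous_attains_sup by metis
  have qS: "q \<in> S" and vq: "v q = v m" using q by (auto simp: A_def K_def)
  obtain \<rho> where \<rho>: "\<rho> > 0" "ball q \<rho> \<subseteq> S" "\<And>r. 0 < r \<Longrightarrow> r < \<rho> \<Longrightarrow>
      v q \<le> 1 / (2 * pi) * integral {0..2 * pi} (\<lambda>t. v (q + of_real r * cis t))"
    using v qS unfolding subharmonic_on_def by blast
  define r where "r = \<rho> / 2"
  have r: "0 < r" "r < \<rho>" using \<rho> by (auto simp: r_def)
  have inS: "q + of_real r * cis t \<in> S" for t
    using \<rho> r by (auto simp: subset_iff dist_norm norm_mult)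
  \<comment> \<open>The defect \<open>g\<close> is continuous and nonnegative with integral 0, hence
    it vanishes; its zero at \<open>t = 0\<close> puts \<open>q + r\<close>, a point to the right of
    \<open>q\<close>, into \<open>A\<close>.\<close>
  define g where "g t = v m - v (q + of_real r * cis t)" for t
  have cg: "continuous_on (cbox 0 (2*pi)) g"
    unfolding g_def using inS by (intro continuous_intros continuous_on_compose2[OF cv]) auto
  have cv': "continuous_on {0..2*pi} (\<lambda>t. v (q + of_real r * cis t))"
    using inS by (intro continuous_intros continuous_on_compose2[OF cv]) auto
  have ge0: "0 \<le> g t" for t using max[OF inS] by (simp add: g_def)
  have "integral {0..2*pi} g = 2 * pi * v m - integral {0..2*pi} (\<lambda>t. v (q + of_real r * cis t))"
    unfolding g_def using cv' by (subst integral_diff) (auto intro: integrable_continuous_interval)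
  also have "\<dots> \<le> 0"
    using \<rho>(3)[OF r] vq by (simp add: field_simps)
  finally have "integral {0..2*pi} g = 0"
    using integral_nonneg[of g "{0..2*pi}"] cg ge0 by (force intro: integrable_continuous_interval)
  then have "(g has_integral 0) (cbox 0 (2*pi))"
    using integrable_continuous[OF cg] by (simp add: has_integral_iff)
  then have "g 0 = 0"
    using has_integral_0_cbox_imp_0[OF cg _ _, of 0] ge0 pi_gt_zero by (simp add: not_le)
  then have "q + of_real r \<in> A"
    using inS[of 0] m by (auto simp: A_def K_def g_def)
  from q(2)[OF this] r show False by simp
qed

section \<open>Products over roots of unity\<close>

text \<open>A weak form of Jordan's inequality: \<open>sin x\<close> is at least
  \<open>x - x ^ 3 / 6\<close>, and \<open>x \<le> 2\<close> gives
  \<open>x ^ 3 / 6 \<le> 2 * x / 3\<close>.\<close>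

lemma third_le_sin:
  assumes "0 \<le> x" "x \<le> pi / 2"
  shows "x / 3 \<le> sin (x::real)"
proof -
  have "x \<le> 2" using assms pi_less_4 by linarith
  then have "x * x \<le> 4" using assms mult_mono[of x 2 x 2] by simp
  then have "x * (x * x) \<le> x * 4" using assms by (intro mult_left_mono) auto
  moreover have "\<bar>sin x - x\<bar> \<le> x ^ 3 / 6"
    using Maclaurin_sin_bound[of x 3] assms by (simp add: sin_coeff_def numeral_eq_Suc)
  ultimately show ?thesis
    unfolding power3_eq_cube mult.assoc by linarith
qed

text \<open>After rotation by the mean argument \<gamma>, every term has argument at most
  \<open>pi / 2\<close> in modulus. No real part is then negative, and the term \<open>j = 0\<close>
  alone contributes \<open>cos \<gamma>\<close>, which is at least
  \<open>sin (pi / (2 * N))\<close>.\<close>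

lemma cmod_geometric_sum_ge:
  assumes N: "0 < N" and \<phi>: "\<bar>\<phi>\<bar> \<le> pi / N" and \<rho>: "0 \<le> \<rho>"
  shows "1 / (3 * real N) \<le> cmod (\<Sum>j<N. rcis \<rho> \<phi> ^ j)"
proof -
  define \<gamma> where "\<gamma> = \<phi> * (real N - 1) / 2"
  have \<gamma>: "\<bar>\<gamma>\<bar> \<le> pi / 2 - pi / (2 * N)"
  proof -
    have "\<bar>\<gamma>\<bar> = \<bar>\<phi>\<bar> * ((real N - 1) / 2)" using N by (simp add: \<gamma>_def abs_mult)
    also have "\<dots> \<le> (pi / N) * ((real N - 1) / 2)" using N \<phi> by (intro mult_right_mono) auto
    also have "\<dots> = pi / 2 - pi / (2 * N)" using N by (simp add: field_simps)
    finally show ?thesis .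
  qed
  have arg: "\<bar>\<phi> * j - \<gamma>\<bar> \<le> pi / 2" if "j < N" for j
  proof -
    have "\<bar>\<phi> * j - \<gamma>\<bar> = \<bar>\<phi>\<bar> * \<bar>j - (real N - 1) / 2\<bar>"
      unfolding \<gamma>_def abs_mult[symmetric] by (simp add: algebra_simps)
    also have "\<dots> \<le> (pi / N) * (real N / 2)"
    proof (intro mult_mono \<phi>)
      have "real j < real N" "0 \<le> real j" using that by auto
      then show "\<bar>j - (real N - 1) / 2\<bar> \<le> real N / 2"
        unfolding abs_le_iff by (simp add: field_simps)
    qed auto
    finally show ?thesis using N by simp
  qed
  have "pi / (2 * N) / 3 \<le> sin (pi / (2 * N))"
    using N by (intro third_le_sin) (auto simp: field_simps)
  then have "1 / (3 * real N) \<le> sin (pi / (2 * N))"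
    using pi_ge_two N by (simp add: field_simps)
  also have "\<dots> = cos (pi / 2 - pi / (2 * N))" by (simp add: cos_diff)
  also have "\<dots> \<le> cos \<bar>\<gamma>\<bar>"
    using \<gamma> N by (intro cos_monotone_0_pi_le) (auto simp: field_simps)
  also have "\<dots> = \<rho> ^ 0 * cos (\<phi> * 0 - \<gamma>)" by simp
  also have "\<dots> \<le> (\<Sum>j<N. \<rho> ^ j * cos (\<phi> * j - \<gamma>))"
  proof -
    have "0 \<le> \<rho> ^ j * cos (\<phi> * j - \<gamma>)" if "j < N" for j
      using arg[OF that] \<rho> unfolding abs_le_iff
      by (intro mult_nonneg_nonneg cos_ge_zero) auto
    then show ?thesis
      using N member_le_sum[of 0 "{..<N}" "\<lambda>j. \<rho> ^ j * cos (\<phi> * real j - \<gamma>)"] by simp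
  qed
  also have "\<dots> = Re (cis (- \<gamma>) * (\<Sum>j<N. rcis \<rho> \<phi> ^ j))"
  proof -
    have "cis (- \<gamma>) * rcis \<rho> \<phi> ^ j = rcis (\<rho> ^ j) (\<phi> * j - \<gamma>)" for j
      by (simp add: DeMoivre2 cis_rcis_eq rcis_mult mult.commute)
    then show ?thesis by (simp add: sum_distrib_left)
  qed
  also have "\<dots> \<le> cmod (cis (- \<gamma>) * (\<Sum>j<N. rcis \<rho> \<phi> ^ j))" by (rule complex_Re_le_cmod)
  finally show ?thesis by (simp add: norm_mult)
qed

text \<open>Both sides are the quotient of \<open>z ^ N - 1\<close> by \<open>z - \<eta>\<close>.
  The cancellation is done between polynomials, so that \<open>z = \<eta>\<close> is
  covered.\<close>

lemma prod_roots_unity_minus_root: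
  assumes N: "0 < N" and \<eta>: "\<eta> ^ N = 1"
  shows "(\<Prod>\<xi>\<in>{\<xi>. \<xi> ^ N = 1} - {\<eta>}. z - \<xi>) = (\<Sum>j<N. z ^ j * \<eta> ^ (N - Suc j) :: complex)"
proof -
  define A where "A = {\<xi>::complex. \<xi> ^ N = 1}"
  define p q where "p = (\<Prod>\<xi>\<in>A - {\<eta>}. [:-\<xi>, 1:])" and "q = (\<Sum>j<N. monom (\<eta> ^ (N - Suc j)) j)"
  have fin: "finite A" unfolding A_def using N by (intro finite_roots_unity) auto
  have "\<eta> \<in> A" using \<eta> by (simp add: A_def)
  define P :: "complex poly" where "P = monom 1 N - 1"
  have "rsquarefree P"
    unfolding rsquarefree_roots
  proof safe
    fix a assume "poly P a = 0" "poly (pderiv P) a = 0"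
    then show False
      using N by (auto simp: P_def pderiv_diff pderiv_monom poly_monom power_0_left)
  qed
  then have "smult (lead_coeff P) (\<Prod>\<xi>\<in>A. [:-\<xi>, 1:]) = P"
    using complex_poly_decompose_rsquarefree[of P] by (simp add: A_def P_def poly_monom)
  moreover have "lead_coeff P = 1"
    unfolding P_def using N lead_coeff_add_le[of "-1" "monom 1 N :: complex poly"]
    by (simp add: degree_monom_eq)
  ultimately have "[:-\<eta>, 1:] * p = P"
    unfolding p_def using \<open>\<eta> \<in> A\<close> fin by (simp add: prod.remove[of A \<eta>])
  moreover have "poly ([:-\<eta>, 1:] * q) = poly P"
  proof
    fix x
    show "poly ([:-\<eta>, 1:] * q) x = poly P x"
      using power_diff_sumr2[of x N \<eta>] \<eta>
      by (simp add: P_def q_def poly_sum poly_monom mult_ac left_diff_distrib)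
  qed
  ultimately have "[:-\<eta>, 1:] * p = [:-\<eta>, 1:] * q"
    by (simp add: poly_eq_poly_eq_iff)
  then have "p = q" by (simp only: mult_cancel_left) simp
  then have "poly p z = poly q z" by simp
  then show ?thesis by (simp add: p_def q_def poly_prod poly_sum poly_monom A_def mult_ac)
qed

text \<open>With \<eta> the root nearest to \<open>z\<close> in argument, the product over the other
  roots has the modulus of a geometric sum with ratio \<open>z / \<eta>\<close>, whose argument is
  at most \<open>pi / N\<close>. Thus only one factor of \<open>z ^ N - 1\<close> can be very
  small.\<close>

lemma prod_roots_unity_minus_nearest_ge:
  fixes z :: complex
  assumes N: "0 < N"
  obtains \<eta> where "\<eta> ^ N = 1" "1 / (3 * real N) \<le> (\<Prod>\<xi>\<in>{\<xi>. \<xi> ^ N = 1} - {\<eta>}. cmod (z - \<xi>))"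
proof -
  define m where "m = round (Arg z * N / (2 * pi))"
  define \<eta> where "\<eta> = cis (2 * pi * m / N)"
  define \<phi> where "\<phi> = Arg z - 2 * pi * m / N"
  have \<eta>: "\<eta> ^ N = 1"
  proof -
    have "real N * (2 * pi * m / N) = 2 * pi * m" using N by simp
    then have "\<eta> ^ N = cis (2 * pi * m)" unfolding \<eta>_def Complex.DeMoivre by (rule arg_cong)
    also have "\<dots> = 1" by (rule cis_multiple_2pi) simp
    finally show ?thesis .
  qed
  have "\<phi> = - ((2 * pi / N) * (of_int m - Arg z * N / (2 * pi)))"
    using N by (simp add: \<phi>_def field_simps)
  then have "\<bar>\<phi>\<bar> = (2 * pi / N) * \<bar>of_int m - Arg z * N / (2 * pi)\<bar>"
    by (simp only: abs_minus_cancel abs_mult) simp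
  also have "\<dots> \<le> (2 * pi / N) * (1 / 2)"
    unfolding m_def by (intro mult_left_mono of_int_round_abs_le) auto
  finally have \<phi>: "\<bar>\<phi>\<bar> \<le> pi / N" by simp
  have z: "z = \<eta> * rcis (cmod z) \<phi>"
    using rcis_cmod_Arg[of z] by (simp add: \<eta>_def \<phi>_def rcis_def cis_mult mult.left_commute)
  have "z ^ j * \<eta> ^ (N - Suc j) = \<eta> ^ (N - 1) * rcis (cmod z) \<phi> ^ j" if "j < N" for j
  proof -
    have "z ^ j * \<eta> ^ (N - Suc j) = \<eta> ^ (j + (N - Suc j)) * rcis (cmod z) \<phi> ^ j"
      by (subst z) (simp add: power_mult_distrib power_add)
    then show ?thesis using that by simp
  qed
  then have "(\<Prod>\<xi>\<in>{\<xi>. \<xi> ^ N = 1} - {\<eta>}. z - \<xi>) = \<eta> ^ (N - 1) * (\<Sum>j<N. rcis (cmod z) \<phi> ^ j)"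
    by (simp add: prod_roots_unity_minus_root[OF N \<eta>] sum_distrib_left)
  then have "cmod (\<Prod>\<xi>\<in>{\<xi>. \<xi> ^ N = 1} - {\<eta>}. z - \<xi>) = cmod (\<Sum>j<N. rcis (cmod z) \<phi> ^ j)"
    by (simp add: norm_mult norm_power \<eta>_def)
  with cmod_geometric_sum_ge[OF N \<phi>, of "cmod z"] \<eta> show thesis
    by (intro that) (auto simp: prod_norm)
qed

section \<open>Univalent functions and Blaschke factors\<close>

text \<open>A Blaschke factor has modulus at most 1 in the disc; the difference of the squared
  moduli factors explicitly.\<close>

lemma cmod_minus_le_cmod_one_minus_cnj_mult:
  assumes "cmod z < 1" "cmod v < 1"
  shows "cmod (z - v) \<le> cmod (1 - cnj v * z)"
proof -
  have "(cmod (1 - cnj v * z))\<^sup>2 - (cmod (z - v))\<^sup>2 = (1 - (cmod v)\<^sup>2) * (1 - (cmod z)\<^sup>2)"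
    unfolding cmod_power2 by (simp add: power2_eq_square algebra_simps)
  moreover have "0 \<le> (1 - (cmod v)\<^sup>2) * (1 - (cmod z)\<^sup>2)"
    using assms power_le_one[of "cmod v" 2] power_le_one[of "cmod z" 2]
    by (intro mult_nonneg_nonneg) auto
  ultimately have "(cmod (z - v))\<^sup>2 \<le> (cmod (1 - cnj v * z))\<^sup>2" by linarith
  then show ?thesis by (rule power2_le_imp_le) simp
qed

lemma one_minus_cnj_mult_nonzero:
  assumes "cmod z < 1" "cmod v < 1"
  shows "1 - cnj v * z \<noteq> 0"
proof
  assume "1 - cnj v * z = 0"
  then have "cmod v * cmod z = 1" using norm_mult[of "cnj v" z] by simp
  moreover have "cmod v * cmod z \<le> cmod v * 1" using assms by (intro mult_left_mono) auto
  ultimately show False using assms by linarith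
qed

text \<open>Dividing \<open>\<psi> - w\<close> by the Blaschke factor of its only possible zero changes the value at \<open>0\<close>
  only by the factor \<open>1 / |v|\<close>, where \<open>v\<close> is that zero, and does not decrease the modulus anywhere.\<close>

lemma conformal_map_minus_const_Blaschke:
  assumes "conformal_map_on_disc \<psi>" and \<psi>0: "\<psi> 0 = 0" and "w \<noteq> 0"
    and \<rho>: "0 < \<rho>" "\<rho> \<le> 1" and far: "\<And>z. z \<in> unit_disc \<Longrightarrow> \<psi> z = w \<Longrightarrow> \<rho> \<le> cmod z"
  obtains h where "h holomorphic_on unit_disc" "\<And>z. z \<in> unit_disc \<Longrightarrow> h z \<noteq> 0"
    "\<And>z. z \<in> unit_disc \<Longrightarrow> cmod (\<psi> z / w - 1) \<le> cmod (h z)" "cmod (h 0) \<le> 1 / \<rho>"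
proof (cases "\<exists>v\<in>unit_disc. \<psi> v = w")
  case False
  have "(\<lambda>z. \<psi> z / w - 1) holomorphic_on unit_disc"
    using assms(1) \<open>w \<noteq> 0\<close> unfolding conformal_map_on_disc_def by (intro holomorphic_intros) auto
  then show ?thesis
    using False \<open>w \<noteq> 0\<close> \<rho> \<psi>0 by (intro that[of "\<lambda>z. \<psi> z / w - 1"]) auto
next
  case True
  have hol: "\<psi> holomorphic_on unit_disc" and inj: "inj_on \<psi> unit_disc"
    using assms(1) by (auto simp: conformal_map_on_disc_def)
  from True obtain v where v: "cmod v < 1" "\<psi> v = w" by auto
  \<comment> \<open>The removable singularity of the difference quotient is filled in. Injectivity
    makes \<open>k\<close> zero-free, at \<open>v\<close> itself because the derivative of an
    injective holomorphic function does not vanish.\<close>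
  define k where "k = (\<lambda>z. if z = v then deriv \<psi> v else (\<psi> z - \<psi> v) / (z - v))"
  define h where "h = (\<lambda>z. k z * (1 - cnj v * z) / w)"
  have "k holomorphic_on unit_disc"
    unfolding k_def by (rule pole_lemma_open[OF hol open_ball])
  then have "h holomorphic_on unit_disc"
    unfolding h_def using \<open>w \<noteq> 0\<close> by (intro holomorphic_on_divide holomorphic_on_mult holomorphic_on_diff
      holomorphic_on_const holomorphic_on_ident)
  moreover have "k z \<noteq> 0" if "z \<in> unit_disc" for z
  proof (cases "z = v")
    case True
    have "deriv \<psi> v \<noteq> 0"
      using v by (intro holomorphic_injective_imp_regular[OF hol open_ball inj]) auto
    then show ?thesis using True by (simp add: k_def)
  next
    case False
    have "\<psi> z \<noteq> \<psi> v" using False v that inj by (auto dest: inj_onD)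
    then show ?thesis using False by (simp add: k_def)
  qed
  then have "h z \<noteq> 0" if "z \<in> unit_disc" for z
    using that v \<open>w \<noteq> 0\<close> one_minus_cnj_mult_nonzero[of z v] by (auto simp: h_def)
  moreover have "cmod (\<psi> z / w - 1) \<le> cmod (h z)" if z: "z \<in> unit_disc" for z
  proof (cases "z = v")
    case False
    have "\<psi> z / w - 1 = k z * (z - v) / w"
      using False v \<open>w \<noteq> 0\<close> by (simp add: k_def field_simps)
    then show ?thesis
      using cmod_minus_le_cmod_one_minus_cnj_mult[of z v] z v
      by (simp add: h_def norm_mult norm_divide mult_left_mono divide_right_mono)
  qed (use v \<open>w \<noteq> 0\<close> in auto)
  moreover have "v \<noteq> 0" using v \<psi>0 \<open>w \<noteq> 0\<close> by auto
  then have "h 0 = 1 / v" using v \<psi>0 \<open>w \<noteq> 0\<close> by (simp add: h_def k_def)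
  then have "cmod (h 0) \<le> 1 / \<rho>"
    using far[of v] v \<rho> \<open>v \<noteq> 0\<close> by (auto simp: norm_divide intro!: divide_left_mono mult_pos_pos)
  ultimately show ?thesis using that by blast
qed

text \<open>The minimum modulus principle: the maximum principle is applied to
  \<open>1 / h\<close>.\<close>

lemma nonvanishing_lower_bound_cball:
  assumes h: "h holomorphic_on cball 0 r" and nz: "\<And>z. z \<in> cball 0 r \<Longrightarrow> h z \<noteq> 0" and "0 < r"
    and B: "0 < B" "\<And>z. cmod z = r \<Longrightarrow> B \<le> cmod (h z)" and z: "z \<in> cball 0 r"
  shows "B \<le> cmod (h z)"
proof -
  have hol: "(\<lambda>z. inverse (h z)) holomorphic_on cball 0 r"
    using h nz by (intro holomorphic_intros) auto
  have "cmod (inverse (h z)) \<le> inverse B"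
  proof (rule maximum_modulus_frontier[where S = "cball 0 r" and f = "\<lambda>z. inverse (h z)"])
    show "(\<lambda>z. inverse (h z)) holomorphic_on interior (cball 0 r)"
      using hol holomorphic_on_subset interior_subset by blast
    show "continuous_on (closure (cball 0 r)) (\<lambda>z. inverse (h z))"
      using hol holomorphic_on_imp_continuous_on by auto
    show "cmod (inverse (h z)) \<le> inverse B" if "z \<in> frontier (cball 0 r)"
      for z using that B \<open>0 < r\<close> by (auto simp: norm_inverse intro!: le_imp_inverse_le)
  qed (use z in auto)
  then show ?thesis
    using B nz[OF z] by (simp add: norm_inverse)
qed

text \<open>The images of two concentric circles are disjoint compact sets, so each \<open>w\<close> keeps a uniform
  distance from at least one of them.\<close>

lemma inj_holomorphic_two_circles:
  assumes \<psi>: "continuous_on unit_disc \<psi>" "inj_on \<psi> unit_disc" and r: "0 < r" "r < 1"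
  obtains \<kappa> where "0 < \<kappa>"
    "\<And>w. \<exists>s. r \<le> s \<and> s < 1 \<and> (\<forall>z. cmod z = s \<longrightarrow> \<kappa> \<le> cmod (\<psi> z - w))"
proof -
  define s where "s = (r + 1) / 2"
  have s: "r < s" "s < 1" using r by (auto simp: s_def)
  have comp: "compact (\<psi> ` sphere 0 t)" if "t < 1" for t
    using that by (intro compact_continuous_image continuous_on_subset[OF \<psi>(1)]) auto
  have "\<psi> ` sphere 0 r \<inter> \<psi> ` sphere 0 s = {}"
    using inj_onD[OF \<psi>(2)] r s by fastforce
  then obtain d where d: "d > 0" "\<And>x y. cmod x = r \<Longrightarrow> cmod y = s \<Longrightarrow> d \<le> dist (\<psi> x) (\<psi> y)"
    using separate_compact_closed[OF comp[of r] compact_imp_closed[OF comp[of s]]] r s by fastforce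
  have "\<exists>s. r \<le> s \<and> s < 1 \<and> (\<forall>z. cmod z = s \<longrightarrow> d / 2 \<le> cmod (\<psi> z - w))" for w
  proof (rule ccontr)
    assume "\<not> ?thesis"
    then have *: "\<And>t. r \<le> t \<Longrightarrow> t < 1 \<Longrightarrow> \<exists>z. cmod z = t \<and> dist (\<psi> z) w < d / 2"
      by (force simp: dist_norm)
    from *[of r] *[of s] r s obtain x y where
      "cmod x = r" "dist (\<psi> x) w < d / 2" "cmod y = s" "dist (\<psi> y) w < d / 2" by auto
    with d(2)[of x y] dist_triangle_half_l[of "\<psi> x" w d "\<psi> y"] show False by simp
  qed
  with d show thesis by (intro that[of "d/2"]) auto
qed

section \<open>The harmonic majorant\<close>

text \<open>\<open>h\<close> is the product of the zero-free functions from
  \<open>conformal_map_minus_const_Blaschke\<close> for \<open>w = R * \<eta>\<close>, with \<eta>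
  running over the \<open>N\<close>-th roots of unity. Each factor is at most
  \<open>1 / \<rho>\<close> at 0, and division by \<open>N\<close> averages the logarithms.\<close>

lemma conformal_log_majorant:
  assumes conf: "conformal_map_on_disc \<psi>" "\<psi> 0 = 0" and "0 < R"
    and \<rho>: "0 < \<rho>" "\<rho> \<le> 1" and far: "\<And>z. z \<in> level_set \<psi> R \<Longrightarrow> \<rho> \<le> cmod z"
    and r: "0 < r" "r < 1" and "0 < \<epsilon>"
  obtains N h where "0 < N" "h holomorphic_on unit_disc" "\<And>z. z \<in> unit_disc \<Longrightarrow> h z \<noteq> 0"
    "ln (cmod (h 0)) / real N \<le> ln (1 / \<rho>)"
    "\<And>z. z \<in> cball 0 r \<Longrightarrow> - \<epsilon> \<le> ln (cmod (h z)) / real N"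
    "\<And>z. z \<in> unit_disc \<Longrightarrow> 4 * R \<le> cmod (\<psi> z) \<Longrightarrow> 1 \<le> ln (cmod (h z)) / real N"
proof -
  have hol: "\<psi> holomorphic_on unit_disc" and inj: "inj_on \<psi> unit_disc"
    using conf(1) by (auto simp: conformal_map_on_disc_def)
  obtain \<kappa> where \<kappa>: "0 < \<kappa>"
    "\<And>w. \<exists>s. r \<le> s \<and> s < 1 \<and> (\<forall>z. cmod z = s \<longrightarrow> \<kappa> \<le> cmod (\<psi> z - w))"
    using inj_holomorphic_two_circles[OF holomorphic_on_imp_continuous_on[OF hol] inj r] by blast
  \<comment> \<open>\<kappa> serves all \<open>w\<close> at once, so \<open>C\<close> is fixed
    before \<open>N\<close>. The lower bound for \<open>cmod (h z)\<close> will be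
    \<open>C / N\<close>, and \<open>N\<close> is chosen so that \<open>ln (C / N) / N\<close>
    exceeds \<open>- \<epsilon>\<close>.\<close>
  define C where "C = \<kappa> / (3 * R)"
  have "C > 0" using \<kappa> \<open>0 < R\<close> by (simp add: C_def)
  have "(\<lambda>N. ln C / real N - ln (real N) / real N) \<longlonglongrightarrow> 0 - 0"
    by (intro tendsto_diff lim_ln_over_n lim_const_over_n)
  then have "eventually (\<lambda>N. - \<epsilon> < ln C / real N - ln (real N) / real N) sequentially"
    using \<open>0 < \<epsilon>\<close> by (intro order_tendstoD(1)) auto
  from eventually_conj[OF this eventually_gt_at_top[of 0]]
  obtain N :: nat where N: "- \<epsilon> < ln C / real N - ln (real N) / real N" "0 < N"
    by (metis (mono_tags, lifting) eventually_sequentially order_refl)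
  define A where "A = {\<xi>::complex. \<xi> ^ N = 1}"
  have A: "finite A" "card A = N" using N card_roots_unity_eq[of N] finite_roots_unity[of N] by (auto simp: A_def)
  have norm1: "cmod \<eta> = 1" if "\<eta> \<in> A" for \<eta>
  proof -
    have "cmod \<eta> ^ N = 1 ^ N" using that by (simp add: A_def flip: norm_power)
    then show ?thesis using N by (intro power_eq_imp_eq_base[of "cmod \<eta>" N 1]) auto
  qed
  have "\<exists>h. h holomorphic_on unit_disc \<and> (\<forall>z\<in>unit_disc. h z \<noteq> 0) \<and>
      (\<forall>z\<in>unit_disc. cmod (\<psi> z / (of_real R * \<eta>) - 1) \<le> cmod (h z)) \<and> cmod (h 0) \<le> 1 / \<rho>" if "\<eta> \<in> A" for \<eta>
  proof -
    have "of_real R * \<eta> \<noteq> 0" "\<And>z. z \<in> unit_disc \<Longrightarrow> \<psi> z = of_real R * \<eta> \<Longrightarrow> \<rho> \<le> cmod z"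
      using norm1[OF that] \<open>0 < R\<close> far by (auto simp: level_set_def norm_mult)
    from conformal_map_minus_const_Blaschke[OF conf this(1) \<rho> this(2)] show ?thesis by metis
  qed
  then obtain H where H: "\<And>\<eta>. \<eta> \<in> A \<Longrightarrow> H \<eta> holomorphic_on unit_disc"
    "\<And>\<eta> z. \<eta> \<in> A \<Longrightarrow> z \<in> unit_disc \<Longrightarrow> H \<eta> z \<noteq> 0"
    "\<And>\<eta> z. \<eta> \<in> A \<Longrightarrow> z \<in> unit_disc \<Longrightarrow> cmod (\<psi> z / (of_real R * \<eta>) - 1) \<le> cmod (H \<eta> z)"
    "\<And>\<eta>. \<eta> \<in> A \<Longrightarrow> cmod (H \<eta> 0) \<le> 1 / \<rho>"
    by metis
  define h where "h = (\<lambda>z. \<Prod>\<eta>\<in>A. H \<eta> z)"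
  have quot: "cmod (\<psi> z / (of_real R * \<eta>) - 1) = cmod (\<psi> z / of_real R - \<eta>)" if "\<eta> \<in> A" for \<eta> z
  proof -
    have "\<eta> \<noteq> 0" using norm1[OF that] by auto
    then have "\<psi> z / of_real R - \<eta> = \<eta> * (\<psi> z / (of_real R * \<eta>) - 1)" using \<open>0 < R\<close> by (simp add: field_simps)
    then show ?thesis using norm1[OF that] by (simp add: norm_mult)
  qed
  have h: "h holomorphic_on unit_disc" unfolding h_def by (intro holomorphic_on_prod H)
  have hnz: "h z \<noteq> 0" if "z \<in> unit_disc" for z using H(2) that A by (simp add: h_def)
  have h0: "ln (cmod (h 0)) / real N \<le> ln (1 / \<rho>)"
  proof -
    have "ln (cmod (h 0)) = (\<Sum>\<eta>\<in>A. ln (cmod (H \<eta> 0)))"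
      unfolding h_def prod_norm[symmetric] using A H(2) by (intro ln_prod) auto
    also have "\<dots> \<le> (\<Sum>\<eta>\<in>A. ln (1 / \<rho>))"
      using H(2,4) \<rho> by (intro sum_mono ln_mono) auto
    finally show ?thesis using A N by (simp add: field_simps)
  qed
  have h1: "- \<epsilon> \<le> ln (cmod (h z)) / real N" if z: "z \<in> cball 0 r" for z
  proof -
    have zD: "z \<in> unit_disc" using z r by auto
    \<comment> \<open>The circle of radius \<open>s\<close> on which \<psi> stays away from
      \<open>R * \<eta>\<close> encloses \<open>cball 0 r\<close>, and \<open>H \<eta>\<close> is
      zero-free, so the bound on that circle passes inside.\<close>
    have low: "\<kappa> / R \<le> cmod (H \<eta> z)" if \<eta>: "\<eta> \<in> A" for \<eta>
    proof -
      obtain s where s: "r \<le> s" "s < 1" "\<And>z. cmod z = s \<Longrightarrow> \<kappa> \<le> cmod (\<psi> z - of_real R * \<eta>)"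
        using \<kappa>(2)[of "of_real R * \<eta>"] by blast
      have sub: "cball 0 s \<subseteq> unit_disc" using s by auto
      show ?thesis
      proof (rule nonvanishing_lower_bound_cball[of "H \<eta>" s])
        show "H \<eta> holomorphic_on cball 0 s" using H(1)[OF \<eta>] sub by (rule holomorphic_on_subset)
        show "\<kappa> / R \<le> cmod (H \<eta> x)" if "cmod x = s" for x
        proof -
          have "\<psi> x - of_real R * \<eta> = of_real R * (\<psi> x / of_real R - \<eta>)" using \<open>0 < R\<close> by (simp add: field_simps)
          then have "cmod (\<psi> x - of_real R * \<eta>) = R * cmod (\<psi> x / (of_real R * \<eta>) - 1)"
            using \<open>0 < R\<close> quot[OF \<eta>, of x] by (simp add: norm_mult)
          then show ?thesis
            using H(3)[OF \<eta>, of x] s(3)[OF that] that s(2) \<open>0 < R\<close>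
            by (simp add: field_simps) (metis mult_left_mono less_imp_le order_trans mult.commute)
        qed
      qed (use s r H(2)[OF \<eta>] sub \<kappa> \<open>0 < R\<close> z in auto)
    qed
    obtain \<eta> where "\<eta> ^ N = 1"
      and \<eta>2: "1 / (3 * real N) \<le> (\<Prod>\<xi>\<in>A - {\<eta>}. cmod (\<psi> z / of_real R - \<xi>))"
      unfolding A_def by (rule prod_roots_unity_minus_nearest_ge[OF \<open>0 < N\<close>])
    then have \<eta>: "\<eta> \<in> A" by (simp add: A_def)
    \<comment> \<open>The factor of the nearest root is bounded by \<open>low\<close>, the product
      of the remaining ones by \<open>\<eta>2\<close>.\<close>
    have "C / N = (\<kappa> / R) * (1 / (3 * real N))" by (simp add: C_def)
    also have "\<dots> \<le> cmod (H \<eta> z) * (\<Prod>\<xi>\<in>A - {\<eta>}. cmod (H \<xi> z))"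
    proof (rule mult_mono[OF low[OF \<eta>]])
      note \<eta>2
      also have "(\<Prod>\<xi>\<in>A - {\<eta>}. cmod (\<psi> z / of_real R - \<xi>)) \<le> (\<Prod>\<xi>\<in>A - {\<eta>}. cmod (H \<xi> z))"
        using H(3)[OF _ zD] quot[of _ z] by (intro prod_mono) auto
      finally show "1 / (3 * real N) \<le> (\<Prod>\<xi>\<in>A - {\<eta>}. cmod (H \<xi> z))" .
    qed auto
    also have "\<dots> = cmod (h z)"
      unfolding h_def prod_norm[symmetric] using A \<eta> by (simp add: prod.remove[of A \<eta>])
    finally have "ln (C / N) \<le> ln (cmod (h z))"
      using \<open>0 < C\<close> N by (intro ln_mono) auto
    then have "(ln C - ln N) / N \<le> ln (cmod (h z)) / N"
      using \<open>0 < C\<close> N by (intro divide_right_mono) (auto simp: ln_div)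
    then show ?thesis using N by (simp add: diff_divide_distrib)
  qed
  have h2: "1 \<le> ln (cmod (h z)) / real N" if z: "z \<in> unit_disc" "4 * R \<le> cmod (\<psi> z)" for z
  proof -
    have "1 \<le> ln (cmod (H \<eta> z))" if \<eta>: "\<eta> \<in> A" for \<eta>
    proof -
      \<comment> \<open>The level \<open>4 * R\<close> is chosen so that \<open>4 - 1 = 3\<close> is
        at least \<open>exp 1\<close>.\<close>
      have "4 \<le> cmod (\<psi> z / of_real R)" using z \<open>0 < R\<close> by (simp add: norm_divide field_simps)
      then have "3 \<le> cmod (\<psi> z / of_real R - \<eta>)"
        using norm_triangle_ineq2[of "\<psi> z / of_real R" \<eta>] norm1[OF \<eta>] by linarith
      then have "exp 1 \<le> cmod (H \<eta> z)"
        using exp_le H(3)[OF \<eta> z(1)] quot[OF \<eta>, of z] by linarith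
      then show ?thesis using H(2)[OF \<eta> z(1)] by (simp add: ln_ge_iff)
    qed
    then have "(\<Sum>\<eta>\<in>A. 1) \<le> (\<Sum>\<eta>\<in>A. ln (cmod (H \<eta> z)))" by (rule sum_mono)
    also have "\<dots> = ln (cmod (h z))"
      unfolding h_def prod_norm[symmetric] using A H(2) z by (intro ln_prod[symmetric]) auto
    finally show ?thesis using A N by simp
  qed
  show thesis by (rule that[OF N(2) h hnz h0 h1 h2])
qed

text \<open>The modulus of \<psi> maps the connected set \<open>S\<close> to an interval that
  contains 0 and omits \<alpha>. For the frontier: a component is relatively closed in the disc
  minus the level set, so a frontier point in that set would lie in the open set
  \<open>S\<close>.\<close>

lemma disc_component_level_set:
  assumes cont: "continuous_on unit_disc \<psi>" and "\<psi> 0 = 0" "0 < \<alpha>"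
  defines "S \<equiv> connected_component_set (unit_disc - level_set \<psi> \<alpha>) 0"
  shows "open S" "0 \<in> S" "S \<subseteq> unit_disc" "\<And>z. z \<in> S \<Longrightarrow> cmod (\<psi> z) < \<alpha>"
    "\<And>\<zeta>. \<zeta> \<in> frontier S \<Longrightarrow> \<zeta> \<in> level_set \<psi> \<alpha> \<or> cmod \<zeta> = 1"
proof -
  define D where "D = unit_disc - level_set \<psi> \<alpha>"
  have SD: "S \<subseteq> D" unfolding S_def D_def by (rule connected_component_subset)
  have D_eq: "D = unit_disc \<inter> (\<lambda>z. cmod (\<psi> z)) -` (- {\<alpha>})"
    by (auto simp: D_def level_set_def)
  have "open D" unfolding D_eq
    by (intro continuous_open_preimage continuous_intros cont) auto
  then show "open S" unfolding S_def D_def by (rule open_connected_component)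
  show 0: "0 \<in> S"
    using assms by (simp add: S_def connected_component_refl_eq level_set_def)
  show SU: "S \<subseteq> unit_disc" using SD by (auto simp: D_def)
  have "connected ((\<lambda>z. cmod (\<psi> z)) ` S)"
    unfolding S_def using SU S_def
    by (intro connected_continuous_image continuous_intros continuous_on_subset[OF cont]) auto
  moreover have "\<alpha> \<notin> (\<lambda>z. cmod (\<psi> z)) ` S" using SD by (auto simp: D_def level_set_def)
  moreover have "0 \<in> (\<lambda>z. cmod (\<psi> z)) ` S" using 0 \<open>\<psi> 0 = 0\<close> by force
  ultimately show "cmod (\<psi> z) < \<alpha>" if "z \<in> S" for z
    using that \<open>0 < \<alpha>\<close> connectedD_interval[of "(\<lambda>z. cmod (\<psi> z)) ` S" 0 "cmod (\<psi> z)" \<alpha>]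
    by (force simp: not_less)
  show "\<zeta> \<in> level_set \<psi> \<alpha> \<or> cmod \<zeta> = 1" if \<zeta>: "\<zeta> \<in> frontier S" for \<zeta>
  proof (rule ccontr)
    assume *: "\<not> ?thesis"
    have cl: "\<zeta> \<in> closure S" and "\<zeta> \<notin> S"
      using \<zeta> \<open>open S\<close> by (auto simp: frontier_def interior_open)
    have "closure S \<subseteq> cball 0 1" using SU by (intro closure_minimal) auto
    then have "\<zeta> \<in> D" using cl * by (auto simp: D_def)
    moreover have "\<zeta> islimpt S" using cl \<open>\<zeta> \<notin> S\<close> by (simp add: closure_def)
    moreover have "closedin (top_of_set D) S"
      unfolding S_def D_def by (rule closedin_connected_component)
    ultimately show False using \<open>\<zeta> \<notin> S\<close> by (simp add: closedin_limpt)
  qed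
qed

lemma perron_family_eventually_less:
  assumes u: "u \<in> perron_family S \<phi>" and "\<zeta> \<in> frontier S" "\<phi> \<zeta> < c"
  shows "eventually (\<lambda>z. u z < c) (at \<zeta> within S)"
proof -
  have "Limsup (at \<zeta> within S) (\<lambda>z. ereal (u z)) < ereal c"
    using assms unfolding perron_family_def by (auto intro: le_less_trans)
  from Limsup_lessD[OF this] show ?thesis by simp
qed

text \<open>The majorant \<open>ln (cmod (h z)) / N\<close> is almost nonnegative only on a compact
  subdisc. The subfunction is therefore first shown to be below \<epsilon> near the unit circle, and
  the maximum principle is applied on \<open>S\<close> cut by a smaller disc.\<close>

lemma perron_subfunction_upper_bound:
  assumes conf: "conformal_map_on_disc \<psi>" "\<psi> 0 = 0" and "0 < R"
    and \<rho>: "0 < \<rho>" "\<rho> \<le> 1" and far: "\<And>z. z \<in> level_set \<psi> R \<Longrightarrow> \<rho> \<le> cmod z"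
    and u: "u \<in> perron_family (connected_component_set (unit_disc - level_set \<psi> (4 * R)) 0)
      (indicator (level_set \<psi> (4 * R)))"
  shows "u 0 \<le> ln (1 / \<rho>)"
proof (rule field_le_epsilon)
  fix e :: real assume "0 < e"
  define \<epsilon> where "\<epsilon> = e / 2"
  have \<epsilon>: "0 < \<epsilon>" using \<open>0 < e\<close> by (simp add: \<epsilon>_def)
  define F where "F = level_set \<psi> (4 * R)"
  define S where "S = connected_component_set (unit_disc - F) 0"
  have cont: "continuous_on unit_disc \<psi>"
    using conf by (auto simp: conformal_map_on_disc_def intro: holomorphic_on_imp_continuous_on)
  note S = disc_component_level_set[OF cont conf(2), of "4 * R", folded F_def, folded S_def]
  have S: "open S" "0 \<in> S" "S \<subseteq> unit_disc" "\<And>\<zeta>. \<zeta> \<in> frontier S \<Longrightarrow> \<zeta> \<in> F \<or> cmod \<zeta> = 1"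
    using S \<open>0 < R\<close> by auto
  have u: "u \<in> perron_family S (indicator F)" using u by (simp add: S_def F_def)
  have subu: "subharmonic_on u S" using u by (simp add: perron_family_def)
  then have cu: "continuous_on S u" by (simp add: subharmonic_on_def)
  have FD: "F \<subseteq> unit_disc" by (auto simp: F_def level_set_def)

  \<comment> \<open>The boundary data vanish on the unit circle, so \<open>P\<close> cannot
    accumulate there; it lies in a disc of some radius \<open>r < 1\<close>. Only then is the
    majorant chosen, for this \<open>r\<close>.\<close>
  define P where "P = {z \<in> S. \<epsilon> \<le> u z}"
  have "closure P \<subseteq> unit_disc"
  proof
    fix \<zeta> assume \<zeta>: "\<zeta> \<in> closure P"
    have "P \<subseteq> S" by (auto simp: P_def)
    have "closure P \<subseteq> cball 0 1" using \<open>P \<subseteq> S\<close> S(3) by (intro closure_minimal) auto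
    show "\<zeta> \<in> unit_disc"
    proof (rule ccontr)
      assume "\<zeta> \<notin> unit_disc"
      then have "\<zeta> \<notin> S" "\<zeta> \<notin> F" using S(3) FD by auto
      have "\<zeta> \<in> frontier S"
        using \<zeta> closure_mono[OF \<open>P \<subseteq> S\<close>] \<open>\<zeta> \<notin> S\<close> S(1) by (auto simp: frontier_def interior_open)
      then have "eventually (\<lambda>z. u z < \<epsilon>) (at \<zeta> within S)"
        using \<epsilon> \<open>\<zeta> \<notin> F\<close> by (intro perron_family_eventually_less[OF u]) auto
      then have "eventually (\<lambda>z. z \<notin> P) (at \<zeta>)"
        unfolding eventually_at_filter by eventually_elim (auto simp: P_def)
      moreover have "\<zeta> islimpt P" using \<zeta> \<open>\<zeta> \<notin> S\<close> \<open>P \<subseteq> S\<close> by (auto simp: closure_def)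
      ultimately show False by (simp add: islimpt_iff_eventually)
    qed
  qed
  moreover have "bounded P" by (rule bounded_subset[of unit_disc]) (use S(3) in \<open>auto simp: P_def\<close>)
  then have "compact (closure P)" by simp
  ultimately have "\<exists>r>0. r < 1 \<and> closure P \<subseteq> ball 0 r"
  proof (cases "closure P = {}")
    case False
    with \<open>compact (closure P)\<close> obtain x where x: "x \<in> closure P" "\<And>y. y \<in> closure P \<Longrightarrow> cmod y \<le> cmod x"
      using continuous_attains_sup[of "closure P" cmod] continuous_on_norm_id by blast
    with \<open>closure P \<subseteq> unit_disc\<close> have "cmod x < 1" by auto
    then show ?thesis
      using x(2) by (intro exI[of _ "(cmod x + 1) / 2"]) (force simp: field_simps intro: add_pos_nonneg)
  qed (auto intro: exI[of _ "1/2"])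
  then obtain r where r: "0 < r" "r < 1" "closure P \<subseteq> ball 0 r" by blast
  then have Pr: "\<And>z. z \<in> P \<Longrightarrow> cmod z < r"
    using closure_subset[of P] by (force simp: subset_iff)

  obtain N h where N: "0 < N" and h: "h holomorphic_on unit_disc" "\<And>z. z \<in> unit_disc \<Longrightarrow> h z \<noteq> 0"
    and h0: "ln (cmod (h 0)) / real N \<le> ln (1 / \<rho>)"
    and h1: "\<And>z. z \<in> cball 0 r \<Longrightarrow> - \<epsilon> \<le> ln (cmod (h z)) / real N"
    and h2: "\<And>z. z \<in> unit_disc \<Longrightarrow> 4 * R \<le> cmod (\<psi> z) \<Longrightarrow> 1 \<le> ln (cmod (h z)) / real N"
    by (rule conformal_log_majorant[OF conf \<open>0 < R\<close> \<rho> far r(1,2) \<epsilon>]) blast+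
  define T where "T = S \<inter> ball 0 r"
  define v where "v z = u z + (- 1 / real N) * ln (cmod (h z)) + (- 2 * \<epsilon>)" for z
  have T: "open T" "T \<subseteq> S" "0 \<in> T" "bounded T" using S r by (auto simp: T_def)
  have "T \<subseteq> unit_disc" using T S by auto
  have ch: "continuous_on unit_disc (\<lambda>z. ln (cmod (h z)))"
    using h by (intro continuous_intros holomorphic_on_imp_continuous_on) auto
  have "subharmonic_on v T"
    unfolding v_def using T S h \<open>T \<subseteq> unit_disc\<close>
    by (intro subharmonic_on_add_scaled_ln_cmod[OF subu] holomorphic_on_subset[OF h(1)]) auto
  moreover have "eventually (\<lambda>z. v z < \<delta>) (at \<zeta> within T)" if \<zeta>: "\<zeta> \<in> frontier T" and "0 < \<delta>" for \<zeta> \<delta>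
  proof -
    have "\<zeta> \<notin> T" using \<zeta> T(1) by (auto simp: frontier_def interior_open)
    have "closure T \<subseteq> closure S \<inter> cball 0 r"
      by (simp add: T_def closure_mono closure_minimal le_infI2 ball_subset_cball)
    then have \<zeta>': "\<zeta> \<in> closure S" "cmod \<zeta> \<le> r" using \<zeta> by (auto simp: frontier_def)
    then have \<zeta>D: "\<zeta> \<in> unit_disc" using r by auto
    show ?thesis
    proof (cases "\<zeta> \<in> S")
      case True
      \<comment> \<open>Here \<zeta> lies on the cutting circle: \<open>u\<close> is below
        \<epsilon> and the majorant is at least \<open>- \<epsilon>\<close>, which the term
        \<open>- 2 * \<epsilon>\<close> in \<open>v\<close> absorbs.\<close>
      then have "\<zeta> \<notin> P" using Pr[of \<zeta>] \<open>\<zeta> \<notin> T\<close> by (auto simp: T_def)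
      then have "v \<zeta> < \<delta>"
        using True h1[of \<zeta>] \<zeta>' \<open>0 < \<delta>\<close> by (auto simp: v_def P_def)
      moreover have "continuous_on S v"
        unfolding v_def using S(3) by (intro continuous_intros cu continuous_on_subset[OF ch])
      then have "(v \<longlongrightarrow> v \<zeta>) (at \<zeta>)"
        using True S(1) by (simp add: continuous_on_eq_continuous_at continuous_at)
      then have "(v \<longlongrightarrow> v \<zeta>) (at \<zeta> within T)" by (rule tendsto_within_subset) auto
      ultimately show ?thesis by (rule order_tendstoD(2)[rotated])
    next
      case False
      \<comment> \<open>Here \<zeta> lies on the level set: near it \<open>u\<close> is below
        \<open>1 + \<epsilon>\<close> and the majorant above \<open>1 - \<epsilon>\<close>.\<close>
      then have fr: "\<zeta> \<in> frontier S" using \<zeta>' S(1) by (auto simp: frontier_def interior_open)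
      then have "\<zeta> \<in> F" using S(4)[OF fr] \<zeta>D by auto
      then have "1 \<le> ln (cmod (h \<zeta>)) / real N"
        using h2[OF \<zeta>D] by (simp add: F_def level_set_def)
      then have "1 - \<epsilon> < ln (cmod (h \<zeta>)) / real N" using \<epsilon> by linarith
      moreover have "((\<lambda>z. ln (cmod (h z)) / real N) \<longlongrightarrow> ln (cmod (h \<zeta>)) / real N) (at \<zeta>)"
        using ch \<zeta>D N by (intro tendsto_divide tendsto_const) (auto simp: continuous_on_eq_continuous_at continuous_at)
      then have "((\<lambda>z. ln (cmod (h z)) / real N) \<longlongrightarrow> ln (cmod (h \<zeta>)) / real N) (at \<zeta> within T)"
        by (rule tendsto_within_subset) auto
      ultimately have "eventually (\<lambda>z. 1 - \<epsilon> < ln (cmod (h z)) / real N) (at \<zeta> within T)"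
        by (rule order_tendstoD(1)[rotated])
      moreover have "eventually (\<lambda>z. u z < 1 + \<epsilon>) (at \<zeta> within S)"
        using \<epsilon> \<open>\<zeta> \<in> F\<close> by (intro perron_family_eventually_less[OF u fr]) auto
      then have "eventually (\<lambda>z. u z < 1 + \<epsilon>) (at \<zeta> within T)"
        using at_le[OF T(2)] by (rule filter_leD[rotated])
      ultimately show ?thesis
        by eventually_elim (use \<open>0 < \<delta>\<close> in \<open>simp add: v_def\<close>)
    qed
  qed
  ultimately have "v 0 \<le> 0"
    using subharmonic_maximum_principle[of v T 0] T by blast
  then show "u 0 \<le> ln (1 / \<rho>) + e"
    using h0 by (simp add: v_def \<epsilon>_def)
qed

section \<open>The Green potential\<close>

lemma exists_cmod_ge_on_circle:
  assumes f: "f holomorphic_on S" and "open S" "cball a t \<subseteq> S" "0 < t"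
  obtains \<zeta> where "dist \<zeta> a = t" "cmod (f a) \<le> cmod (f \<zeta>)"
proof -
  have cont: "continuous_on (cball a t) f"
    using assms holomorphic_on_imp_continuous_on continuous_on_subset by blast
  then have "continuous_on (sphere a t) (\<lambda>z. cmod (f z))"
    by (intro continuous_on_norm continuous_on_subset[OF cont]) auto
  then obtain \<zeta> where \<zeta>: "\<zeta> \<in> sphere a t" "\<And>z. z \<in> sphere a t \<Longrightarrow> cmod (f z) \<le> cmod (f \<zeta>)"
    using continuous_attains_sup[of "sphere a t" "\<lambda>z. cmod (f z)"] \<open>0 < t\<close> by auto
  have "cmod (f a) \<le> cmod (f \<zeta>)"
  proof (rule maximum_modulus_frontier[where S = "cball a t" and f = f])
    show "f holomorphic_on interior (cball a t)"
      using f assms(3) interior_subset by (blast intro: holomorphic_on_subset)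
  qed (use cont \<zeta> \<open>0 < t\<close> in auto)
  then show thesis using \<zeta> that by (auto simp: dist_commute)
qed

text \<open>A discrete form of the integrability of \<open>ln (1 / t)\<close> at 0. Since
  \<open>N / j \<ge> 1\<close>, each term is at most \<open>ln 13 + ln (N / j)\<close>; the last
  logarithms add up to \<open>ln (N ^ N / fact N)\<close>, and \<open>N ^ N / fact N\<close> is a
  term of the series of \<open>exp N\<close>.\<close>

lemma sum_ln_ratio_le:
  "(\<Sum>j=1..N. ln (1 + 12 * real N / real j)) \<le> real N * (ln 13 + 1)"
proof (cases "N = 0")
  case False
  have "real N ^ N / fact N \<le> (\<Sum>k<Suc N. real N ^ k / fact k)"
    by (intro member_le_sum[of N "{..<Suc N}" "\<lambda>k. real N ^ k / fact k"]) auto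
  also have "\<dots> \<le> exp (real N)"
  proof -
    have "(\<lambda>k. real N ^ k / fact k) sums exp (real N)"
      using exp_converges[of "real N"] by (simp add: divide_inverse mult.commute)
    then show ?thesis
      using sum_le_suminf[of "\<lambda>k. real N ^ k / fact k" "{..<Suc N}"] by (simp add: sums_iff)
  qed
  finally have *: "ln (real N ^ N / fact N) \<le> real N"
    using False ln_mono[of "real N ^ N / fact N" "exp (real N)"] by simp
  have "(\<Sum>j=1..N. ln (1 + 12 * real N / real j)) \<le> (\<Sum>j=1..N. ln 13 + ln (real N / real j))"
  proof (rule sum_mono)
    fix j assume j: "j \<in> {1..N}"
    then have "1 + 12 * real N / real j \<le> 13 * (real N / real j)" by (simp add: field_simps)
    then have "ln (1 + 12 * real N / real j) \<le> ln (13 * (real N / real j))"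
      using j by (intro ln_mono) (auto intro: add_pos_nonneg)
    also have "\<dots> = ln 13 + ln (real N / real j)" using j by (intro ln_mult_pos) auto
    finally show "ln (1 + 12 * real N / real j) \<le> ln 13 + ln (real N / real j)" .
  qed
  also have "\<dots> = real N * ln 13 + (\<Sum>j=1..N. ln (real N / real j))" by (simp add: sum.distrib)
  also have "(\<Sum>j=1..N. ln (real N / real j)) = ln (\<Prod>j=1..N. real N / real j)"
    by (intro ln_prod[symmetric]) auto
  also have "(\<Prod>j=1..N. real N / real j) = real N ^ N / fact N"
    by (simp add: prod_dividef fact_prod)
  finally show ?thesis using * by (simp add: algebra_simps)
qed simp

text \<open>Let \<open>m\<close> be an index nearest to \<open>x\<close>. Any other \<open>k\<close>
  has distance at least \<open>\<bar>m - k\<bar> / 2\<close> from \<open>x\<close>, which turns 6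
  into 12, and each value of \<open>\<bar>m - k\<bar>\<close> occurs at most twice. The term of
  \<open>m\<close> is controlled only through \<delta>.\<close>

lemma sum_ln_distance_le:
  fixes x :: real
  assumes "0 < N" and y: "\<And>k. k \<in> {1..N} \<Longrightarrow> \<bar>x - real k\<bar> \<le> y k" "\<And>k. k \<in> {1..N} \<Longrightarrow> \<delta> \<le> y k" and "0 < \<delta>"
  shows "(\<Sum>k=1..N. ln (1 + 6 * real N / y k)) \<le> 2 * (real N * (ln 13 + 1)) + ln (1 + 6 * real N / \<delta>)"
proof -
  define m where "m = arg_min_on (\<lambda>k. \<bar>x - real k\<bar>) {1..N}"
  have m: "m \<in> {1..N}" and near: "\<And>k. k \<in> {1..N} \<Longrightarrow> \<bar>x - real m\<bar> \<le> \<bar>x - real k\<bar>"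
    using arg_min_if_finite(1)[of "{1..N}" "\<lambda>k. \<bar>x - real k\<bar>"] arg_min_least[of "{1..N}" _ "\<lambda>k. \<bar>x - real k\<bar>"] \<open>0 < N\<close>
    unfolding m_def by auto
  define g where "g j = ln (1 + 12 * real N / real j)" for j
  have g0: "0 \<le> g j" for j by (simp add: g_def)
  have far: "ln (1 + 6 * real N / y k) \<le> g j" if "k \<in> {1..N}" "\<bar>real m - real k\<bar> = real j" "0 < j" for k j
  proof -
    have "real j \<le> 2 * y k" using near[OF that(1)] y(1)[OF that(1)] that(2) by linarith
    then have "6 * real N / y k \<le> 12 * real N / real j"
      using that(3) \<open>0 < N\<close> by (simp add: field_simps)
    then show ?thesis unfolding g_def
      using \<open>0 < \<delta>\<close> y(2)[OF that(1)] by (intro ln_mono) (auto intro: add_pos_nonneg)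
  qed
  have "{1..N} = insert m ({1..<m} \<union> {m<..N})" using m by auto
  then have "(\<Sum>k=1..N. ln (1 + 6 * real N / y k)) = ln (1 + 6 * real N / y m)
      + ((\<Sum>k=1..<m. ln (1 + 6 * real N / y k)) + (\<Sum>k\<in>{m<..N}. ln (1 + 6 * real N / y k)))"
    by (simp, subst sum.union_disjoint) auto
  also have "ln (1 + 6 * real N / y m) \<le> ln (1 + 6 * real N / \<delta>)"
    using y(2)[OF m] \<open>0 < \<delta>\<close> by (intro ln_mono add_left_mono divide_left_mono) (auto intro: add_pos_nonneg)
  also have "(\<Sum>k=1..<m. ln (1 + 6 * real N / y k)) \<le> (\<Sum>k=1..<m. g (m - k))"
    using m by (intro sum_mono far) (auto simp: of_nat_diff)
  also have "\<dots> = sum g ((\<lambda>k. m - k) ` {1..<m})"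
    by (subst sum.reindex) (auto simp: inj_on_def)
  also have "\<dots> \<le> sum g {1..N}" using m g0 by (intro sum_mono2) auto
  also have "(\<Sum>k\<in>{m<..N}. ln (1 + 6 * real N / y k)) \<le> (\<Sum>k\<in>{m<..N}. g (k - m))"
    using m by (intro sum_mono far) (auto simp: of_nat_diff)
  also have "\<dots> = sum g ((\<lambda>k. k - m) ` {m<..N})"
    by (subst sum.reindex) (auto simp: inj_on_def)
  also have "\<dots> \<le> sum g {1..N}" using m g0 by (intro sum_mono2) auto
  also have "sum g {1..N} \<le> real N * (ln 13 + 1)" unfolding g_def by (rule sum_ln_ratio_le)
  finally show ?thesis by simp
qed

text \<open>The subfunction is the average of \<open>N\<close> Green functions of the disc, divided
  by a constant \<open>C\<close>. Their poles satisfy \<open>cmod (\<psi> z) > \<alpha>\<close>,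
  hence lie outside \<open>S\<close>, and spreading them over circles of different radii keeps the
  average bounded on \<open>S\<close>.\<close>

lemma perron_subfunction_lower_bound:
  assumes hol: "\<psi> holomorphic_on unit_disc" and \<psi>0: "\<psi> 0 = 0" and \<alpha>: "0 < \<alpha>" "\<alpha> < cmod (\<psi> z0)"
    and z0: "z0 \<in> unit_disc"
  obtains u where
    "u \<in> perron_family (connected_component_set (unit_disc - level_set \<psi> \<alpha>) 0) (indicator (level_set \<psi> \<alpha>))"
    "(1 - cmod z0) / (2 * (2 * (ln 13 + 1) + 1)) \<le> u 0"
proof -
  define F where "F = level_set \<psi> \<alpha>"
  define S where "S = connected_component_set (unit_disc - F) 0"
  define s where "s = (1 - cmod z0) / 2"
  define C where "C = 2 * (ln 13 + 1) + (1::real)"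
  have s: "0 < s" "cmod z0 + s < 1" using z0 by (auto simp: s_def field_simps)
  have C: "0 < C" by (simp add: C_def add_pos_pos)
  have cont: "continuous_on unit_disc \<psi>" using hol by (rule holomorphic_on_imp_continuous_on)
  have S: "open S" "0 \<in> S" "S \<subseteq> unit_disc" "\<And>z. z \<in> S \<Longrightarrow> cmod (\<psi> z) < \<alpha>"
    "\<And>\<zeta>. \<zeta> \<in> frontier S \<Longrightarrow> \<zeta> \<in> F \<or> cmod \<zeta> = 1"
    using disc_component_level_set[OF cont \<psi>0 \<alpha>(1), folded F_def, folded S_def] by auto
  have sub: "cball z0 s \<subseteq> unit_disc"
  proof
    fix z assume "z \<in> cball z0 s"
    then show "z \<in> unit_disc"
      using norm_triangle_ineq[of z0 "z - z0"] s by (simp add: dist_norm norm_minus_commute)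
  qed

  \<comment> \<open>All poles will lie in the compact set \<open>K\<close>, so their distance
    \<delta> from \<open>S\<close> is positive and independent of \<open>N\<close>. \<open>Z\<close>
    is closed only relative to the disc, hence the passage to its closure.\<close>
  define K where "K = {\<zeta> \<in> cball z0 s. cmod (\<psi> z0) \<le> cmod (\<psi> \<zeta>)}"
  define Z where "Z = {z \<in> unit_disc. cmod (\<psi> z) \<le> \<alpha>}"
  have "compact K"
  proof -
    have "continuous_on (cball z0 s) (\<lambda>z. cmod (\<psi> z))"
      by (intro continuous_on_norm continuous_on_subset[OF cont] sub)
    moreover have "K = cball z0 s \<inter> (\<lambda>z. cmod (\<psi> z)) -` {cmod (\<psi> z0)..}" by (auto simp: K_def)
    ultimately have "closed K" by (simp add: continuous_closed_preimage)
    moreover have "bounded K" by (rule bounded_subset[OF bounded_cball[of z0 s]]) (auto simp: K_def)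
    ultimately show ?thesis by (simp add: compact_eq_bounded_closed)
  qed
  moreover have "K \<inter> closure Z = {}"
  proof (safe, simp)
    fix \<zeta> assume \<zeta>: "\<zeta> \<in> K" "\<zeta> \<in> closure Z"
    have "Z = unit_disc \<inter> (\<lambda>z. cmod (\<psi> z)) -` {..\<alpha>}" by (auto simp: Z_def)
    then have "closedin (top_of_set unit_disc) Z"
      using continuous_closedin_preimage[OF continuous_on_norm[OF cont] closed_atMost[of \<alpha>]] by simp
    moreover have "\<zeta> \<in> unit_disc" using \<zeta>(1) sub by (auto simp: K_def)
    ultimately have "\<zeta> \<in> Z"
      using \<zeta>(2) by (auto simp: closedin_limpt closure_def)
    then show False using \<zeta>(1) \<alpha>(2) by (simp add: K_def Z_def)
  qed
  ultimately obtain \<delta> where \<delta>: "0 < \<delta>" "\<And>\<zeta> z. \<zeta> \<in> K \<Longrightarrow> z \<in> Z \<Longrightarrow> \<delta> \<le> dist \<zeta> z"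
    using separate_compact_closed[of K "closure Z"] closure_subset[of Z] by (auto simp: subset_iff)

  \<comment> \<open>With this \<open>N\<close> the single term for the nearest pole,
    \<open>ln (1 + 6 * s / \<delta>)\<close>, is at most \<open>N\<close>; it accounts for the final
    \<open>+ 1\<close> in \<open>C\<close>.\<close>
  obtain N :: nat where N: "max 1 (ln (1 + 6 * s / \<delta>)) \<le> real N" using real_arch_simple by blast
  then have N0: "0 < N" by (cases N) auto
  have "\<exists>\<zeta>. dist \<zeta> z0 = s * real k / real N \<and> cmod (\<psi> z0) \<le> cmod (\<psi> \<zeta>)" if k: "k \<in> {1..N}" for k
  proof -
    have "0 < s * real k / real N" "s * real k / real N \<le> s"
      using k s N0 by (auto simp: field_simps)
    then have "cball z0 (s * real k / real N) \<subseteq> unit_disc" using sub by (meson cball_subset_cball_iff order_trans subset_cball)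
    from exists_cmod_ge_on_circle[OF hol open_ball this] show ?thesis
      using \<open>0 < s * real k / real N\<close> by metis
  qed
  then obtain \<zeta> where \<zeta>: "\<And>k. k \<in> {1..N} \<Longrightarrow> dist (\<zeta> k) z0 = s * real k / real N"
    "\<And>k. k \<in> {1..N} \<Longrightarrow> cmod (\<psi> z0) \<le> cmod (\<psi> (\<zeta> k))" by metis
  have \<zeta>s: "dist (\<zeta> k) z0 \<le> s" if "k \<in> {1..N}" for k
  proof -
    have "s * real k \<le> s * real N" using that s by (intro mult_left_mono) auto
    then show ?thesis using \<zeta>(1)[OF that] N0 by (simp add: divide_le_eq)
  qed
  have \<zeta>K: "\<zeta> k \<in> K" if "k \<in> {1..N}" for k
    using \<zeta>s[OF that] \<zeta>(2)[OF that] by (simp add: K_def dist_commute)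
  have \<zeta>1: "cmod (\<zeta> k) \<le> 1 - s" "1 - 3 * s \<le> cmod (\<zeta> k)" if "k \<in> {1..N}" for k
  proof -
    have "cmod z0 = 1 - 2 * s" by (simp add: s_def field_simps)
    then show "cmod (\<zeta> k) \<le> 1 - s" "1 - 3 * s \<le> cmod (\<zeta> k)"
      using \<zeta>s[OF that] norm_triangle_ineq2[of "\<zeta> k" z0] norm_triangle_ineq2[of z0 "\<zeta> k"]
      unfolding dist_norm norm_minus_commute[of z0] by linarith+
  qed
  have \<zeta>D: "cmod (\<zeta> k) < 1" if "k \<in> {1..N}" for k using \<zeta>1[OF that] s by simp
  have SZ: "S \<subseteq> Z" using S(3,4) by (force simp: Z_def)
  have far: "\<delta> \<le> cmod (z - \<zeta> k)" if "k \<in> {1..N}" "z \<in> S" for k z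
    using \<delta>(2)[OF \<zeta>K[OF that(1)]] that(2) SZ by (auto simp: dist_norm norm_minus_commute)

  \<comment> \<open>The factors are reciprocals of Blaschke factors, so
    \<open>ln (cmod (q z))\<close> is the sum of the Green functions with poles
    \<open>\<zeta> k\<close>.\<close>
  define q where "q z = (\<Prod>k=1..N. (1 - cnj (\<zeta> k) * z) / (z - \<zeta> k))" for z
  define u where "u z = 1 / (real N * C) * ln (cmod (q z))" for z
  have ne: "1 - cnj (\<zeta> k) * z \<noteq> 0" "z - \<zeta> k \<noteq> 0" if "k \<in> {1..N}" "z \<in> S" for k z
    using one_minus_cnj_mult_nonzero[of z "\<zeta> k"] \<zeta>D[OF that(1)] that(2) S(3) far[OF that] \<delta>(1) by auto
  have lnq: "ln (cmod (q z)) = (\<Sum>k=1..N. ln (cmod ((1 - cnj (\<zeta> k) * z) / (z - \<zeta> k))))" if "z \<in> S" for z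
    unfolding q_def prod_norm[symmetric] using ne that by (intro ln_prod) auto
  have qhol: "q holomorphic_on S"
    unfolding q_def[abs_def] using ne
    by (intro holomorphic_on_prod holomorphic_on_divide holomorphic_on_diff holomorphic_on_mult
      holomorphic_on_const holomorphic_on_ident) auto
  have qne: "q z \<noteq> 0" if "z \<in> S" for z using ne that by (auto simp: q_def)
  have sub_u: "subharmonic_on u S"
    unfolding u_def[abs_def] using S(1) qhol qne by (rule subharmonic_on_scaled_ln_cmod)
  have le1: "u z \<le> 1" if z: "z \<in> S" for z
  proof -
    \<comment> \<open>The distance to the \<open>k\<close>-th pole in units of \<open>s / N\<close>,
      the spacing of the circles. By the reverse triangle inequality it is at least
      \<open>\<bar>x - k\<bar>\<close>, where \<open>x\<close> is the distance from \<open>z\<close>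
      to \<open>z0\<close> in the same units.\<close>
    define y where "y k = real N * cmod (z - \<zeta> k) / s" for k
    have "ln (cmod ((1 - cnj (\<zeta> k) * z) / (z - \<zeta> k))) \<le> ln (1 + 6 * real N / y k)" if k: "k \<in> {1..N}" for k
    proof (intro ln_mono)
      have "1 - cnj (\<zeta> k) * z = of_real (1 - (cmod (\<zeta> k))\<^sup>2) - cnj (\<zeta> k) * (z - \<zeta> k)"
        by (simp only: of_real_diff of_real_1 complex_norm_square) (simp add: algebra_simps)
      also have "cmod \<dots> \<le> \<bar>1 - (cmod (\<zeta> k))\<^sup>2\<bar> + cmod (\<zeta> k) * cmod (z - \<zeta> k)"
        using norm_triangle_ineq4[of "of_real (1 - (cmod (\<zeta> k))\<^sup>2)" "cnj (\<zeta> k) * (z - \<zeta> k)"]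
        unfolding norm_of_real norm_mult complex_mod_cnj .
      also have "\<dots> \<le> 6 * s + 1 * cmod (z - \<zeta> k)"
      proof (intro add_mono mult_right_mono)
        have "1 - (cmod (\<zeta> k))\<^sup>2 = (1 - cmod (\<zeta> k)) * (1 + cmod (\<zeta> k))"
          by (simp add: power2_eq_square algebra_simps)
        also have "\<dots> \<le> (3 * s) * 2"
          using \<zeta>1[OF k] \<zeta>D[OF k] s by (intro mult_mono) auto
        finally show "\<bar>1 - (cmod (\<zeta> k))\<^sup>2\<bar> \<le> 6 * s"
          using \<zeta>D[OF k] power_le_one[of "cmod (\<zeta> k)" 2] by simp
      qed (use \<zeta>D[OF k] in auto)
      finally show "cmod ((1 - cnj (\<zeta> k) * z) / (z - \<zeta> k)) \<le> 1 + 6 * real N / y k"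
        using ne[OF k z] s N0 by (simp add: y_def norm_divide field_simps)
    qed (use ne[OF k z] in auto)
    then have "ln (cmod (q z)) \<le> (\<Sum>k=1..N. ln (1 + 6 * real N / y k))"
      unfolding lnq[OF z] by (rule sum_mono)
    also have "\<dots> \<le> 2 * (real N * (ln 13 + 1)) + ln (1 + 6 * real N / (real N * \<delta> / s))"
    proof (rule sum_ln_distance_le[OF N0])
      fix k assume k: "k \<in> {1..N}"
      have "\<bar>cmod (z - z0) - s * real k / real N\<bar> \<le> cmod (z - \<zeta> k)"
        using norm_triangle_ineq3[of "z - z0" "\<zeta> k - z0"] \<zeta>(1)[OF k] by (simp add: dist_norm)
      then have "real N / s * \<bar>cmod (z - z0) - s * real k / real N\<bar> \<le> real N / s * cmod (z - \<zeta> k)"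
        using s by (intro mult_left_mono) auto
      moreover have "real N / s * \<bar>cmod (z - z0) - s * real k / real N\<bar> = \<bar>real N * cmod (z - z0) / s - real k\<bar>"
      proof -
        have "real N / s * (cmod (z - z0) - s * real k / real N) = real N * cmod (z - z0) / s - real k"
          using s N0 by (simp add: field_simps)
        moreover have "\<bar>real N / s\<bar> = real N / s" using s by simp
        ultimately show ?thesis by (metis abs_mult)
      qed
      ultimately show "\<bar>real N * cmod (z - z0) / s - real k\<bar> \<le> y k" by (simp add: y_def)
      show "real N * \<delta> / s \<le> y k"
        unfolding y_def using far[OF k z] s by (intro divide_right_mono mult_left_mono) auto
    qed (use N0 \<delta> s in auto)
    also have "6 * real N / (real N * \<delta> / s) = 6 * s / \<delta>" using N0 \<delta> s by (simp add: field_simps)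
    also have "2 * (real N * (ln 13 + 1)) + ln (1 + 6 * s / \<delta>) \<le> real N * C"
      using N by (simp add: C_def algebra_simps)
    finally show ?thesis using N0 C by (simp add: u_def field_simps)
  qed
  have u0: "s / C \<le> u 0"
  proof -
    \<comment> \<open>At 0 the Green function is \<open>ln (1 / cmod (\<zeta> k))\<close>, at least
      \<open>1 - cmod (\<zeta> k)\<close> and so at least \<open>s\<close>.\<close>
    have "s \<le> ln (cmod ((1 - cnj (\<zeta> k) * 0) / (0 - \<zeta> k)))" if k: "k \<in> {1..N}" for k
    proof -
      have "\<zeta> k \<noteq> 0" using ne(2)[OF k S(2)] by auto
      then have "ln (cmod (\<zeta> k)) \<le> cmod (\<zeta> k) - 1" by (intro ln_le_minus_one) auto
      then show ?thesis using \<zeta>1(1)[OF k] \<open>\<zeta> k \<noteq> 0\<close> by (simp add: norm_divide ln_div)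
    qed
    then have "(\<Sum>k=1..N. s) \<le> ln (cmod (q 0))" unfolding lnq[OF S(2)] by (rule sum_mono)
    then show ?thesis using N0 C by (simp add: u_def field_simps)
  qed
  have "u \<in> perron_family S (indicator F)"
    unfolding perron_family_def
  proof (intro CollectI conjI ballI sub_u)
    have "bounded S" using S(3) bounded_subset by blast
    then obtain B where "\<And>z. z \<in> S \<Longrightarrow> cmod z \<le> B" by (auto simp: bounded_iff)
    then have "eventually (\<lambda>z. z \<notin> S) at_infinity"
      unfolding eventually_at_infinity by (intro exI[of _ "B + 1"]) force
    then show "Limsup (inf at_infinity (principal S)) (\<lambda>z. ereal (u z)) \<le> 0"
      by (intro Limsup_bounded) (auto simp: eventually_inf_principal elim: eventually_mono)
  next
    fix w assume w: "w \<in> frontier S"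
    show "Limsup (at w within S) (\<lambda>z. ereal (u z)) \<le> ereal (indicator F w)"
    proof (cases "w \<in> F")
      case True
      have "eventually (\<lambda>z. ereal (u z) \<le> ereal (indicator F w)) (at w within S)"
        using True le1 by (auto simp: eventually_at_filter)
      then show ?thesis by (rule Limsup_bounded)
    next
      case False
      \<comment> \<open>Off the level set the frontier lies on the unit circle, where Blaschke
        factors have modulus 1; hence \<open>u\<close> tends to 0.\<close>
      then have w1: "cmod w = 1" using S(5)[OF w] by blast
      have wne: "w - \<zeta> k \<noteq> 0" if "k \<in> {1..N}" for k using \<zeta>D[OF that] w1 by auto
      have "cmod ((1 - cnj (\<zeta> k) * w) / (w - \<zeta> k)) = 1" if k: "k \<in> {1..N}" for k
      proof -
        have "w * cnj w = 1" using w1 complex_norm_square[of w] by simp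
        then have "1 - cnj (\<zeta> k) * w = w * cnj (w - \<zeta> k)" by (simp add: algebra_simps)
        then have "cmod (1 - cnj (\<zeta> k) * w) = cmod (w - \<zeta> k)"
          by (simp only: norm_mult complex_mod_cnj w1 mult_1)
        then show ?thesis using wne[OF k] by (simp add: norm_divide)
      qed
      then have qw: "cmod (q w) = 1" unfolding q_def prod_norm[symmetric] by simp
      have "(q \<longlongrightarrow> q w) (at w within S)"
        unfolding q_def[abs_def] using wne by (intro tendsto_intros) auto
      then have "(u \<longlongrightarrow> 1 / (real N * C) * ln (cmod (q w))) (at w within S)"
        unfolding u_def[abs_def] using qw by (intro tendsto_mult tendsto_const tendsto_ln tendsto_norm) auto
      then have "(u \<longlongrightarrow> 0) (at w within S)" by (simp add: qw)
      then have "eventually (\<lambda>z. u z \<le> e) (at w within S)" if "0 < e" for e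
        by (rule eventually_mono[OF order_tendstoD(2)[OF _ that]]) simp
      then have *: "Limsup (at w within S) (\<lambda>z. ereal (u z)) \<le> ereal e" if "0 < e" for e
        using that by (intro Limsup_bounded) simp
      have "Limsup (at w within S) (\<lambda>z. ereal (u z)) \<le> 0"
        by (rule ereal_le_epsilon2) (simp add: *)
      then show ?thesis using False by (simp add: zero_ereal_def)
    qed
  qed
  moreover have "(1 - cmod z0) / (2 * (2 * (ln 13 + 1) + 1)) \<le> u 0"
    using u0 by (simp add: s_def C_def)
  ultimately show thesis by (intro that) (auto simp: S_def F_def)
qed

section \<open>Comparison of harmonic measure and hyperbolic distance\<close>

lemma hyp_dist_0: "hyp_dist 0 w = ln ((1 + cmod w) / (1 - cmod w))"
  by (simp add: hyp_dist_def)

text \<open>\<open>ln (c * \<alpha>) / ln \<alpha>\<close> tends to 1 and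
  \<open>k / ln \<alpha>\<close> to 0. Both limits are finite and the first is nonzero, so the
  extended-real limit rules also cover an infinite \<mu>.\<close>

lemma tendsto_div_ln_rescale:
  fixes d :: "real \<Rightarrow> ereal"
  assumes d: "((\<lambda>\<alpha>. d \<alpha> / ereal (ln \<alpha>)) \<longlongrightarrow> \<mu>) at_top" and "0 < c"
  shows "((\<lambda>\<alpha>. (d (c * \<alpha>) + ereal k) / ereal (ln \<alpha>)) \<longlongrightarrow> \<mu>) at_top"
proof -
  have small: "((\<lambda>\<alpha>. a / ln \<alpha>) \<longlongrightarrow> 0) at_top" for a :: real
    by (rule tendsto_divide_0[OF tendsto_const filterlim_at_top_imp_at_infinity[OF ln_at_top]])
  have "filterlim (\<lambda>\<alpha>. c * \<alpha>) at_top at_top"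
    using \<open>0 < c\<close> by (intro filterlim_tendsto_pos_mult_at_top[OF tendsto_const _ filterlim_ident])
  then have 1: "((\<lambda>\<alpha>. d (c * \<alpha>) / ereal (ln (c * \<alpha>))) \<longlongrightarrow> \<mu>) at_top"
    by (rule filterlim_compose[OF d])
  have "((\<lambda>\<alpha>. 1 + ln c / ln \<alpha>) \<longlongrightarrow> 1 + 0) at_top"
    by (intro tendsto_add tendsto_const small)
  then have 2: "((\<lambda>\<alpha>. ereal (1 + ln c / ln \<alpha>)) \<longlongrightarrow> 1) at_top"
    by (simp add: one_ereal_def)
  have "((\<lambda>\<alpha>. ereal (k / ln \<alpha>)) \<longlongrightarrow> 0) at_top"
    using small[of k] by (simp add: zero_ereal_def)
  moreover have "((\<lambda>\<alpha>. d (c * \<alpha>) / ereal (ln (c * \<alpha>)) * ereal (1 + ln c / ln \<alpha>)) \<longlongrightarrow> \<mu> * 1) at_top"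
    by (rule tendsto_mult_ereal[OF 1 2]) auto
  ultimately have "((\<lambda>\<alpha>. d (c * \<alpha>) / ereal (ln (c * \<alpha>)) * ereal (1 + ln c / ln \<alpha>) + ereal (k / ln \<alpha>)) \<longlongrightarrow> \<mu> * 1 + 0) at_top"
    by (intro tendsto_add_ereal_general1) auto
  then have lim: "((\<lambda>\<alpha>. d (c * \<alpha>) / ereal (ln (c * \<alpha>)) * ereal (1 + ln c / ln \<alpha>) + ereal (k / ln \<alpha>)) \<longlongrightarrow> \<mu>) at_top"
    by simp
  have "eventually (\<lambda>\<alpha>. d (c * \<alpha>) / ereal (ln (c * \<alpha>)) * ereal (1 + ln c / ln \<alpha>) + ereal (k / ln \<alpha>)
      = (d (c * \<alpha>) + ereal k) / ereal (ln \<alpha>)) at_top"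
    using eventually_gt_at_top[of "max 1 (1 / c)"]
  proof eventually_elim
    case (elim \<alpha>)
    then have pos: "0 < ln \<alpha>" "0 < ln (c * \<alpha>)" "0 < \<alpha>" using \<open>0 < c\<close> by (auto simp: field_simps)
    then have *: "1 + ln c / ln \<alpha> = ln (c * \<alpha>) / ln \<alpha>" using \<open>0 < c\<close> by (simp add: ln_mult field_simps)
    show ?case unfolding * using pos by (cases "d (c * \<alpha>)") (auto simp: field_simps)
  qed
  from tendsto_cong[OF this] lim show ?thesis by blast
qed

lemma zero_in_perron_family: "open S \<Longrightarrow> (\<lambda>_. 0) \<in> perron_family S (indicator F)"
  unfolding perron_family_def
  using subharmonic_on_scaled_ln_cmod[of S "\<lambda>_. 1" 0]
  by (auto intro!: Limsup_bounded simp: zero_ereal_def[symmetric])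

text \<open>The level set may accumulate on the unit circle, so compactness is available only after
  cutting it at the modulus of one of its points.\<close>

lemma level_set_min_cmod:
  assumes cont: "continuous_on unit_disc \<psi>" and "level_set \<psi> R \<noteq> {}"
  obtains w where "w \<in> level_set \<psi> R" "\<And>z. z \<in> level_set \<psi> R \<Longrightarrow> cmod w \<le> cmod z"
proof -
  obtain w1 where w1: "w1 \<in> level_set \<psi> R" using assms by auto
  define K where "K = cball 0 (cmod w1) \<inter> (\<lambda>z. cmod (\<psi> z)) -` {R}"
  have "cmod w1 < 1" using w1 by (simp add: level_set_def)
  then have "continuous_on (cball 0 (cmod w1)) (\<lambda>z. cmod (\<psi> z))"
    by (intro continuous_on_norm continuous_on_subset[OF cont]) auto
  then have "closed K" unfolding K_def by (intro continuous_closed_preimage) auto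
  moreover have "bounded K" by (rule bounded_subset[OF bounded_cball[of 0 "cmod w1"]]) (auto simp: K_def)
  ultimately have "compact K" by (simp add: compact_eq_bounded_closed)
  moreover have "w1 \<in> K" using w1 by (simp add: K_def level_set_def)
  ultimately obtain w where w: "w \<in> K" "\<And>z. z \<in> K \<Longrightarrow> cmod w \<le> cmod z"
    using continuous_attains_inf[of K cmod] continuous_on_norm_id by blast
  show thesis
  proof (rule that[of w])
    show "w \<in> level_set \<psi> R" using w(1) \<open>cmod w1 < 1\<close> by (auto simp: K_def level_set_def)
    show "cmod w \<le> cmod z" if "z \<in> level_set \<psi> R" for z
    proof (cases "cmod z \<le> cmod w1")
      case True
      then show ?thesis using that by (intro w(2)) (simp add: K_def level_set_def)
    next
      case False
      then show ?thesis using w(2)[OF \<open>w1 \<in> K\<close>] by simp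
    qed
  qed
qed

section \<open>Two-sided bounds for the harmonic measure of a level set\<close>

context
  fixes \<psi> :: "complex \<Rightarrow> complex"
  assumes conf: "conformal_map_on_disc \<psi>" "\<psi> 0 = 0"
begin

lemma conformal_continuous_on: "continuous_on unit_disc \<psi>"
  using conf by (auto simp: conformal_map_on_disc_def intro: holomorphic_on_imp_continuous_on)

lemma harmonic_measure_level_set_le:
  assumes "0 < R" "0 < \<rho>" "\<rho> \<le> 1" "\<And>z. z \<in> level_set \<psi> R \<Longrightarrow> \<rho> \<le> cmod z"
  shows "harmonic_measure unit_disc 0 (level_set \<psi> (4 * R)) \<le> ln (1 / \<rho>)"
  unfolding harmonic_measure_def perron_solution_def
proof (rule cSUP_least)
  have "open (connected_component_set (unit_disc - level_set \<psi> (4 * R)) 0)"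
    using disc_component_level_set(1)[OF conformal_continuous_on conf(2), of "4 * R"] \<open>0 < R\<close> by simp
  from zero_in_perron_family[OF this] show "perron_family (connected_component_set (unit_disc - level_set \<psi> (4 * R)) 0)
      (indicator (level_set \<psi> (4 * R))) \<noteq> {}" by blast
qed (rule perron_subfunction_upper_bound[OF conf assms])

text \<open>A real supremum dominates its members only if the family is bounded above. The bound
  comes from \<open>perron_subfunction_upper_bound\<close> at level \<open>\<alpha> / 4\<close>,
  whose level set avoids a neighbourhood of 0 by continuity.\<close>

lemma harmonic_measure_level_set_ge:
  assumes "0 < \<alpha>" and u: "u \<in> perron_family (connected_component_set (unit_disc - level_set \<psi> \<alpha>) 0)
      (indicator (level_set \<psi> \<alpha>))"
  shows "u 0 \<le> harmonic_measure unit_disc 0 (level_set \<psi> \<alpha>)"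
proof -
  have "isCont \<psi> 0"
    using conformal_continuous_on by (simp add: continuous_on_eq_continuous_at)
  then have "(\<psi> \<longlongrightarrow> 0) (at 0)" using conf(2) by (simp add: isCont_def)
  then have "eventually (\<lambda>z. dist (\<psi> z) 0 < \<alpha> / 4) (at 0)"
    using \<open>0 < \<alpha>\<close> by (intro tendstoD) auto
  then obtain e where e: "0 < e" "\<And>z. z \<noteq> 0 \<Longrightarrow> cmod z < e \<Longrightarrow> cmod (\<psi> z) < \<alpha> / 4"
    by (auto simp: eventually_at)
  have far: "min e 1 \<le> cmod z" if "z \<in> level_set \<psi> (\<alpha> / 4)" for z
  proof (rule ccontr)
    assume "\<not> min e 1 \<le> cmod z"
    then have "cmod (\<psi> z) < \<alpha> / 4" using e(2)[of z] conf(2) \<open>0 < \<alpha>\<close> by (cases "z = 0") auto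
    with that show False by (simp add: level_set_def)
  qed
  show ?thesis
    unfolding harmonic_measure_def perron_solution_def
  proof (rule cSUP_upper[OF u])
    show "bdd_above ((\<lambda>u. u 0) ` perron_family (connected_component_set (unit_disc - level_set \<psi> \<alpha>) 0)
        (indicator (level_set \<psi> \<alpha>)))"
      using perron_subfunction_upper_bound[OF conf, of "\<alpha> / 4" "min e 1"] far e(1) \<open>0 < \<alpha>\<close>
      by (intro bdd_aboveI2[where M = "ln (1 / min e 1)"]) auto
  qed
qed

lemma harmonic_measure_level_set_nonneg:
  assumes "0 < \<alpha>"
  shows "0 \<le> harmonic_measure unit_disc 0 (level_set \<psi> \<alpha>)"
  using harmonic_measure_level_set_ge[OF assms zero_in_perron_family]
    disc_component_level_set(1)[OF conformal_continuous_on conf(2) assms] by blast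

lemma log_inverse_harmonic_measure_ge:
  assumes "0 < R" and half: "\<And>z. z \<in> level_set \<psi> R \<Longrightarrow> 1 / 2 \<le> cmod z"
  shows "hyp_setdist 0 (level_set \<psi> R) + ereal (- ln 3)
    \<le> log_inverse (harmonic_measure unit_disc 0 (level_set \<psi> (4 * R)))"
proof -
  define \<omega> where "\<omega> = harmonic_measure unit_disc 0 (level_set \<psi> (4 * R))"
  have \<omega>0: "0 \<le> \<omega>" unfolding \<omega>_def using \<open>0 < R\<close> by (intro harmonic_measure_level_set_nonneg) simp
  show ?thesis
  proof (cases "level_set \<psi> R = {} \<or> \<omega> = 0")
    \<comment> \<open>For an empty level set the distance condition is vacuous, so
      \<open>\<rho> = 1\<close> is allowed and gives \<open>\<omega> \<le> ln 1 = 0\<close>.\<close>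
    case True
    then have "\<omega> = 0"
      using harmonic_measure_level_set_le[OF \<open>0 < R\<close>, of 1] \<omega>0 by (force simp: \<omega>_def)
    then show ?thesis by (simp add: \<omega>_def log_inverse_def)
  next
    case False
    then obtain w where w: "w \<in> level_set \<psi> R" "\<And>z. z \<in> level_set \<psi> R \<Longrightarrow> cmod w \<le> cmod z"
      using level_set_min_cmod[OF conformal_continuous_on] by metis
    define \<rho> where "\<rho> = cmod w"
    have \<rho>: "1 / 2 \<le> \<rho>" "\<rho> < 1" using half[OF w(1)] w(1) by (auto simp: \<rho>_def level_set_def)
    have "\<omega> \<le> ln (1 / \<rho>)"
      unfolding \<omega>_def using w \<rho> by (intro harmonic_measure_level_set_le \<open>0 < R\<close>) (auto simp: \<rho>_def)
    also have "\<dots> \<le> 1 / \<rho> - 1" using \<rho> by (intro ln_le_minus_one) auto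
    \<comment> \<open>\<open>\<rho> \<ge> 1 / 2\<close> gives
      \<open>1 + \<rho> \<le> 3 * \<rho>\<close>; this is the source of \<open>ln 3\<close>.\<close>
    also have "\<dots> \<le> 3 * ((1 - \<rho>) / (1 + \<rho>))"
    proof -
      have "(1 - \<rho>) * (1 + \<rho>) \<le> (1 - \<rho>) * (3 * \<rho>)" using \<rho> by (intro mult_left_mono) auto
      then show ?thesis using \<rho> by (simp add: field_simps)
    qed
    finally have "1 / 3 * ((1 + \<rho>) / (1 - \<rho>)) \<le> inverse \<omega>"
      using False \<omega>0 \<rho> by (simp add: field_simps)
    then have "ln (1 / 3 * ((1 + \<rho>) / (1 - \<rho>))) \<le> ln (inverse \<omega>)"
      using \<rho> by (intro ln_mono) auto
    also have "ln (1 / 3 * ((1 + \<rho>) / (1 - \<rho>))) = hyp_dist 0 w - ln 3"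
      using \<rho> by (subst ln_mult_pos) (auto simp: hyp_dist_0 \<rho>_def ln_div)
    finally have "ereal (hyp_dist 0 w) + ereal (- ln 3) \<le> log_inverse \<omega>"
      using False by (simp add: log_inverse_def)
    moreover have "hyp_setdist 0 (level_set \<psi> R) \<le> ereal (hyp_dist 0 w)"
      unfolding hyp_setdist_def using w(1) by (rule INF_lower)
    ultimately show ?thesis
      unfolding \<omega>_def by (meson add_right_mono order_trans)
  qed
qed

text \<open>Every point \<open>z\<close> of the higher level set can serve as \<open>z0\<close> in
  \<open>perron_subfunction_lower_bound\<close>, and \<open>1 / (1 - cmod z)\<close> is at most the
  exponential of \<open>hyp_dist 0 z\<close>. The infimum over \<open>z\<close> gives the claim,
  trivially when that set is empty.\<close>

lemma log_inverse_harmonic_measure_le: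
  assumes "0 < \<alpha>" "\<alpha> < \<beta>"
  shows "log_inverse (harmonic_measure unit_disc 0 (level_set \<psi> \<alpha>))
    \<le> hyp_setdist 0 (level_set \<psi> \<beta>) + ereal (ln (2 * (2 * (ln 13 + 1) + 1)))"
proof -
  define \<omega> where "\<omega> = harmonic_measure unit_disc 0 (level_set \<psi> \<alpha>)"
  define C where "C = 2 * (2 * (ln 13 + 1) + (1::real))"
  have C: "0 < C" by (simp add: C_def add_pos_pos)
  have "log_inverse \<omega> - ereal (ln C) \<le> ereal (hyp_dist 0 z)" if z: "z \<in> level_set \<psi> \<beta>" for z
  proof -
    have z1: "cmod z < 1" using z by (simp add: level_set_def)
    have "(1 - cmod z) / C \<le> \<omega>"
    proof (rule perron_subfunction_lower_bound[of \<psi> \<alpha> z])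
      fix u assume u: "u \<in> perron_family (connected_component_set (unit_disc - level_set \<psi> \<alpha>) 0)
        (indicator (level_set \<psi> \<alpha>))" "(1 - cmod z) / (2 * (2 * (ln 13 + 1) + 1)) \<le> u 0"
      show ?thesis
        using harmonic_measure_level_set_ge[OF assms(1) u(1)] u(2) by (simp add: \<omega>_def C_def)
    qed (use conf z assms in \<open>auto simp: conformal_map_on_disc_def level_set_def\<close>)
    moreover have "0 < (1 - cmod z) / C" using z1 C by simp
    ultimately have \<omega>: "0 < \<omega>" "inverse \<omega> \<le> C / (1 - cmod z)"
      using le_imp_inverse_le by (force, fastforce)
    have "ln (inverse \<omega>) \<le> ln (C * ((1 + cmod z) / (1 - cmod z)))"
    proof (rule ln_mono)
      have "C / (1 - cmod z) \<le> C * ((1 + cmod z) / (1 - cmod z))"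
        using z1 C by (simp add: divide_right_mono)
      with \<omega>(2) show "inverse \<omega> \<le> C * ((1 + cmod z) / (1 - cmod z))" by linarith
    qed (use \<omega> in auto)
    also have "\<dots> = ln C + hyp_dist 0 z"
      unfolding hyp_dist_0 using C z1 by (intro ln_mult_pos) (auto intro!: divide_pos_pos add_pos_nonneg)
    finally show ?thesis using \<omega>(1) by (simp add: log_inverse_def)
  qed
  then have "log_inverse \<omega> - ereal (ln C) \<le> hyp_setdist 0 (level_set \<psi> \<beta>)"
    unfolding hyp_setdist_def by (rule INF_greatest)
  then show ?thesis
    by (simp add: ereal_minus_le \<omega>_def C_def)
qed

lemma eventually_level_set_half:
  "eventually (\<lambda>R. \<forall>z\<in>level_set \<psi> R. 1 / 2 \<le> cmod z) at_top"
proof -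
  have "compact (\<psi> ` cball 0 (1/2))"
    by (intro compact_continuous_image continuous_on_subset[OF conformal_continuous_on]) auto
  then obtain B where B: "\<And>z. z \<in> cball 0 (1/2) \<Longrightarrow> cmod (\<psi> z) \<le> B"
    using compact_imp_bounded by (force simp: bounded_iff)
  show ?thesis
    using eventually_gt_at_top[of B]
  proof eventually_elim
    case (elim R)
    show ?case
    proof (intro ballI, rule ccontr)
      fix z assume "z \<in> level_set \<psi> R" "\<not> 1 / 2 \<le> cmod z"
      then show False using B[of z] elim by (simp add: level_set_def)
    qed
  qed
qed

end

theorem theorem1p2:
  fixes \<psi> :: "complex \<Rightarrow> complex" and \<mu> :: ereal
  assumes "conformal_map_on_disc \<psi>" and "\<psi> 0 = 0"
    and "0 \<le> \<mu>"
    and "((\<lambda>\<alpha>::real. hyp_setdist 0 (level_set \<psi> \<alpha>) / ereal (ln \<alpha>)) \<longlongrightarrow> \<mu>) at_top"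
  shows "\<exists>L::ereal. 0 \<le> L \<and>
    ((\<lambda>\<alpha>::real. log_inverse (harmonic_measure unit_disc 0 (level_set \<psi> \<alpha>)) / ereal (ln \<alpha>))
       \<longlongrightarrow> L) at_top \<and> L = \<mu>"
proof -
  let ?d = "\<lambda>\<alpha>. hyp_setdist 0 (level_set \<psi> \<alpha>)"
  let ?\<omega> = "\<lambda>\<alpha>. harmonic_measure unit_disc 0 (level_set \<psi> \<alpha>)"
  have "((\<lambda>\<alpha>. log_inverse (?\<omega> \<alpha>) / ereal (ln \<alpha>)) \<longlongrightarrow> \<mu>) at_top"
  \<comment> \<open>The level \<open>\<alpha> / 4\<close> compensates the factor 4 of the upper
    estimate for harmonic measure; the factor 2 only provides a level strictly above
    \<alpha>.\<close>
  proof (rule tendsto_sandwich)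
    show "((\<lambda>\<alpha>. (?d (1 / 4 * \<alpha>) + ereal (- ln 3)) / ereal (ln \<alpha>)) \<longlongrightarrow> \<mu>) at_top"
      by (rule tendsto_div_ln_rescale[OF assms(4)]) simp
    show "((\<lambda>\<alpha>. (?d (2 * \<alpha>) + ereal (ln (2 * (2 * (ln 13 + 1) + 1)))) / ereal (ln \<alpha>)) \<longlongrightarrow> \<mu>) at_top"
      by (rule tendsto_div_ln_rescale[OF assms(4)]) simp
    have "filterlim (\<lambda>\<alpha>. 1 / 4 * \<alpha> :: real) at_top at_top"
      by (intro filterlim_tendsto_pos_mult_at_top[OF tendsto_const _ filterlim_ident]) auto
    then have "eventually (\<lambda>\<alpha>. \<forall>z\<in>level_set \<psi> (1 / 4 * \<alpha>). 1 / 2 \<le> cmod z) at_top"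
      using eventually_level_set_half[OF assms(1,2)] by (rule eventually_compose_filterlim[rotated])
    then show "eventually (\<lambda>\<alpha>. (?d (1 / 4 * \<alpha>) + ereal (- ln 3)) / ereal (ln \<alpha>)
        \<le> log_inverse (?\<omega> \<alpha>) / ereal (ln \<alpha>)) at_top"
      using eventually_gt_at_top[of 1]
    proof eventually_elim
      case (elim \<alpha>)
      then have "?d (1 / 4 * \<alpha>) + ereal (- ln 3) \<le> log_inverse (?\<omega> (4 * (1 / 4 * \<alpha>)))"
        by (intro log_inverse_harmonic_measure_ge[OF assms(1,2)]) auto
      then show ?case using elim by (intro ereal_divide_right_mono) auto
    qed
    show "eventually (\<lambda>\<alpha>. log_inverse (?\<omega> \<alpha>) / ereal (ln \<alpha>)
        \<le> (?d (2 * \<alpha>) + ereal (ln (2 * (2 * (ln 13 + 1) + 1)))) / ereal (ln \<alpha>)) at_top"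
      using eventually_gt_at_top[of 1]
    proof eventually_elim
      case (elim \<alpha>)
      then show ?case
        by (intro ereal_divide_right_mono log_inverse_harmonic_measure_le[OF assms(1,2)]) auto
    qed
  qed
  with assms(3) show ?thesis by blast
qed

end
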